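(* Let $\Pi$ be a mini-gringo program and let $\mathcal{J}$ be a set of precomputed atoms. Then $\mathcal{J}$ is a stable model of $\Pi$ if and only if the standard interpretation $\mathcal{J}^\uparrow$ of $\sigma_0$ is a stable model of the set of sentences $\tau^*\Pi$, where the comparison symbols $\neq,<,>,\leq,\geq$ are classified as extensional and the predicate constants $p/n$ as intensional.
   Context: Mini-gringo syntax. Fix three disjoint countably infinite sets of symbols: numerals, symbolic constants and variables, with a bijection between integers and numerals (the numeral for the integer $n$ is written $\overline{n}$). Precomputed terms are numerals and symbolic constants; a total order $<$ on precomputed terms is fixed such that $\overline{m}<\overline{n}$ iff $m<n$. Terms are formed from precomputed terms and variables using the unary absolute value $|\cdot|$ and the binary operations $+,-,\times,/,\backslash,..$. An atom is $p(t_1,\dots,t_n)$ with $p$ a symbolic constant and $t_i$ terms (just $p$ if $n=0$); the predicate symbol $p/n$ occurs in it. A literal is an atom $A$, $\mathit{not}\ A$, or $\mathit{not}\ \mathit{not}\ A$. A comparison is $t_1\ \mathit{rel}\ t_2$ with $\mathit{rel}$ among $=,\neq,<,>,\leq,\geq$. A rule is $\mathit{Head}\leftarrow\mathit{Body}$, where $\mathit{Body}$ is a possibly empty conjunction of literals and comparisons, and $\mathit{Head}$ is an atom (basic rule), an atom in braces $\{A\}$ (choice rule), or empty (constraint). A program is a finite set of rules. A term or rule is ground if it has no variables; an atom is precomputed if all its arguments are precomputed terms. Values. Every ground term $t$ has a finite set $[t]$ of precomputed terms: $[t]=\{t\}$ if $t$ is precomputed; $[|t_1|]=\{\overline{|n|}:\overline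 n\in[t_1]\}$; $[t_1\ \mathit{op}\ t_2]=\{\overline{n_1\ \mathit{op}\ n_2}:\overline{n_1}\in[t_1],\overline{n_2}\in[t_2]\}$ for $\mathit{op}\in\{+,-,\times\}$; $[t_1/t_2]=\{\overline{\mathit{round}(n_1/n_2)}:\overline{n_1}\in[t_1],\overline{n_2}\in[t_2],n_2\neq0\}$; $[t_1\backslash t_2]=\{\overline{n_1-n_2\cdot\mathit{round}(n_1/n_2)}:\overline{n_1}\in[t_1],\overline{n_2}\in[t_2],n_2\neq 0\}$; $[t_1..t_2]=\{\overline m: n_1\le m\le n_2 \text{ for some } \overline{n_1}\in[t_1],\overline{n_2}\in[t_2]\}$; here $\mathit{round}(x)=\lfloor x\rfloor$ if $x\ge0$ and $\lceil x\rceil$ if $x<0$ (so e.g. $[\overline 2+c]=\emptyset$ for a symbolic constant $c$). For a tuple $\mathbf t$, $[\mathbf t]$ is the set of tuples $\mathbf r$ with $r_i\in[t_i]$. Semantics. For ground $p(\mathbf t)$: $\tau(p(\mathbf t))=\bigvee_{\mathbf r\in[\mathbf t]}p(\mathbf r)$, $\tau(\mathit{not}\ p(\mathbf t))=\bigvee_{\mathbf r\in[\mathbf t]}\neg p(\mathbf r)$, $\tau(\mathit{not}\ \mathit{not}\ p(\mathbf t))=\bigvee_{\mathbf r\in[\mathbf t]}\neg\neg p(\mathbf r)$; $\tau(t_1\ \mathit{rel}\ t_2)$ is $\top$ if $\mathit{rel}$ holds (w.r.t. the fixed order) between some $r_1\in[t_1]$ and some $r_2\in[t_2]$, and $\bot$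 otherwise; $\tau$ of a body is the conjunction of $\tau$ of its conjunctive terms; $\tau(p(\mathbf t)\leftarrow\mathit{Body})=\tau(\mathit{Body})\to\bigwedge_{\mathbf r\in[\mathbf t]}p(\mathbf r)$; $\tau(\{p(\mathbf t)\}\leftarrow\mathit{Body})=\tau(\mathit{Body})\to\bigwedge_{\mathbf r\in[\mathbf t]}(p(\mathbf r)\lor\neg p(\mathbf r))$; $\tau(\leftarrow\mathit{Body})=\neg\tau(\mathit{Body})$. An instance of a rule is obtained by substituting precomputed terms for its variables; $\tau\Pi$ is the set of $\tau R$ for all instances $R$ of rules of $\Pi$. A stable model of $\Pi$ is a set of precomputed atoms that is a stable model (answer set) of the propositional theory $\tau\Pi$ in the sense of Ferraris (2005). Signature $\sigma_0$. Two-sorted signature with sort general and its subsort integer; every precomputed term is an object constant (sort integer iff it is a numeral); $|\cdot|$ unary and $+,-,\times$ binary function constants with arguments and values of sort integer; each predicate symbol $p/n$ is an $n$-ary predicate constant with arguments of sort general; $\neq,<,>,\le,\ge$ are binary predicate constants with arguments of sort general (comparison symbols). Mini-gringo variables are general variables of $\sigma_0$. An interpretation of $\sigma_0$ is standard if its general domain is the set of precomputed terms, its integer domain is the set of numerals, every object constant denotes itself, $|\cdot|,+,-,\times$ are interpreted as usual in arithmetic, and comparison symbols are interpreted by the fixed total order. For a set $\mathcal J$ of precomputed atoms, $\mathcal J^\uparrow$ is the standard interpretation making a precomputed atom true iff it is in $\mathcal J$. Translation $\tau^*$. For a term $t$ and general variable $V$ not in $t$, $\mathit{val}_t(V)$ is: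 $V=t$ if $t$ is precomputed or a variable; $\exists I(\mathit{val}_{t_1}(I)\land V=|I|)$ if $t=|t_1|$; $\exists IJ(\mathit{val}_{t_1}(I)\land\mathit{val}_{t_2}(J)\land V=I\ \mathit{op}\ J)$ if $t=t_1\ \mathit{op}\ t_2$, $\mathit{op}\in\{+,-,\times\}$; $\exists IJK(\mathit{val}_{t_1}(I)\land\mathit{val}_{t_2}(J)\land K\times|J|\le|I|<(K+\overline1)\times|J|\land((I\times J\ge\overline0\land V=K)\lor(I\times J<\overline0\land V=-K)))$ if $t=t_1/t_2$; the same but with $V=I-K\times J$ and $V=I+K\times J$ in place of $V=K$, $V=-K$ if $t=t_1\backslash t_2$; $\exists IJK(\mathit{val}_{t_1}(I)\land\mathit{val}_{t_2}(J)\land I\le K\le J\land V=K)$ if $t=t_1..t_2$; $I,J,K$ are fresh integer variables. For tuples, $\mathit{val}_{\mathbf t}(\mathbf V)$ is the conjunction of $\mathit{val}_{t_i}(V_i)$. $\tau^B$ maps $p(\mathbf t)$ to $\exists\mathbf V(\mathit{val}_{\mathbf t}(\mathbf V)\land p(\mathbf V))$, $\mathit{not}\ p(\mathbf t)$ to $\exists\mathbf V(\mathit{val}_{\mathbf t}(\mathbf V)\land\neg p(\mathbf V))$, $\mathit{not}\ \mathit{not}\ p(\mathbf t)$ to $\exists\mathbf V(\mathit{val}_{\mathbf t}(\mathbf V)\land\neg\neg p(\mathbf V))$, $t_1\ \mathit{rel}\ t_2$ to $\exists V_1V_2(\mathit{val}_{t_1}(V_1)\land\mathit{val}_{t_2}(V_2)\land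 V_1\ \mathit{rel}\ V_2)$, and a body to the conjunction of the translations. For a rule of $\Pi$: $\tau^*(p(\mathbf t)\leftarrow\mathit{Body})=\widetilde\forall(\mathit{val}_{\mathbf t}(\mathbf V)\land\tau^B(\mathit{Body})\to p(\mathbf V))$; $\tau^*(\{p(\mathbf t)\}\leftarrow\mathit{Body})=\widetilde\forall(\mathit{val}_{\mathbf t}(\mathbf V)\land\tau^B(\mathit{Body})\land\neg\neg p(\mathbf V)\to p(\mathbf V))$; $\tau^*(\leftarrow\mathit{Body})=\widetilde\forall(\tau^B(\mathit{Body})\to\bot)$; $\mathbf V$ is the list of alphabetically first general variables not occurring in $\Pi$ and $\widetilde\forall$ denotes universal closure. $\tau^*\Pi=\{\tau^*R:R\in\Pi\}$. Stable models of many-sorted theories. Let $\sigma$ be a many-sorted signature with predicate constants partitioned into intensional and extensional. For an interpretation $I$, $\sigma^I$ adds a name $d^*$ (object constant) for every domain element $d$, interpreted as $d$; $I^\downarrow$ is the set of atoms $p(\mathbf d^* )$ with $p$ intensional satisfied by $I$. An HT-interpretation is $\langle\mathcal H,I\rangle$ with $\mathcal H\subseteq I^\downarrow$; for sentences over $\sigma^I$: $\langle\mathcal H,I\rangle\models_{ht}p(\mathbf t)$ iff $p((\mathbf t^I)^* )\in\mathcal H$ when $p$ is intensional, iff $I\models p(\mathbf t)$ when $p$ is extensional; $\models_{ht}t_1=t_2$ iff $t_1^I=t_2^I$; $\bot$ is never satisfied; $\land,\lor$ are treated componentwise; $\langle\mathcal H,I\rangle\models_{ht}F\to G$ iff ($\langle\mathcal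 H,I\rangle\not\models_{ht}F$ or $\langle\mathcal H,I\rangle\models_{ht}G$) and $I\models F\to G$; $\forall X\,F(X)$ (resp. $\exists X\,F(X)$) is satisfied iff $F(d^* )$ is satisfied for all (resp. some) $d$ in the domain of the sort of $X$. ($\neg F$ abbreviates $F\to\bot$.) A model $I$ of a set $\Gamma$ of sentences is stable if for no proper subset $\mathcal H$ of $I^\downarrow$ does $\langle\mathcal H,I\rangle$ satisfy all members of $\Gamma$. *)

theory Defs
  imports Complex_Main "HOL-Library.Infinite_Set" "HOL-Library.Countable_Set"
begin

section \<open>Preliminaries\<close>

text \<open>An arbitrary enumeration of a finite set. It is used for finite conjunctions, disjunctions and
  strings of quantifiers whose order is immaterial.\<close>

definition list_of :: "'a set \<Rightarrow> 'a list" where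
  "list_of A = (SOME xs. distinct xs \<and> set xs = A)"

lemma list_of: "finite A \<Longrightarrow> distinct (list_of A) \<and> set (list_of A) = A"
  unfolding list_of_def by (rule someI_ex) (metis finite_distinct_list)


section \<open>Mini-gringo programs\<close>

text \<open>The type \<open>'c\<close> is the set of symbolic constants. Variables are represented by natural numbers,
  which also serve as their alphabetical order.\<close>

datatype 'c precomputed = Numeral int | Symbol 'c

datatype mg_op = Add | Sub | Mul | Div | Mod | Interval

datatype 'c mg_term =
    Pre "'c precomputed"
  | MVar nat
  | Abs "'c mg_term"
  | Bin mg_op "'c mg_term" "'c mg_term"

datatype 'c mg_atom = Atom 'c "'c mg_term list"

datatype 'c literal = Pos "'c mg_atom" | Neg "'c mg_atom" | NegNeg "'c mg_atom"

text \<open>In the first-order signature below, equality is a logical symbol, while the other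
  five relations are predicate constants.\<close>

datatype comparison = Neq | Less | Greater | Leq | Geq

datatype mg_rel = Equal | Comparison comparison

datatype 'c conjunct = Lit "'c literal" | Comp mg_rel "'c mg_term" "'c mg_term"

datatype 'c head = Basic "'c mg_atom" | Choice "'c mg_atom" | Constraint

datatype 'c mg_rule = Rule (head: "'c head") (body: "'c conjunct list")

type_synonym 'c program = "'c mg_rule set"

text \<open>The pair \<open>(p, [r\<^sub>1, \<dots>, r\<^sub>n])\<close> is the precomputed atom \<open>p(r\<^sub>1, \<dots>, r\<^sub>n)\<close>.\<close>

type_synonym 'c patom = "'c \<times> 'c precomputed list"

text \<open>The first argument of the relations and translations below is the strict
  total order on precomputed terms.\<close>

definition precomputed_order :: "('c precomputed \<Rightarrow> 'c precomputed \<Rightarrow> bool) \<Rightarrow> bool" where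
  "precomputed_order lt \<longleftrightarrow>
     irreflp lt \<and> transp lt \<and> totalp lt \<and> (\<forall>m n. lt (Numeral m) (Numeral n) \<longleftrightarrow> m < n)"

fun comparison_holds ::
    "('c precomputed \<Rightarrow> 'c precomputed \<Rightarrow> bool) \<Rightarrow> comparison \<Rightarrow> 'c precomputed \<Rightarrow> 'c precomputed \<Rightarrow> bool"
  where
  "comparison_holds lt Neq r s \<longleftrightarrow> r \<noteq> s"
| "comparison_holds lt Less r s \<longleftrightarrow> lt r s"
| "comparison_holds lt Greater r s \<longleftrightarrow> lt s r"
| "comparison_holds lt Leq r s \<longleftrightarrow> r = s \<or> lt r s"
| "comparison_holds lt Geq r s \<longleftrightarrow> r = s \<or> lt s r"

fun rel_holds ::
    "('c precomputed \<Rightarrow> 'c precomputed \<Rightarrow> bool) \<Rightarrow> mg_rel \<Rightarrow> 'c precomputed \<Rightarrow> 'c precomputed \<Rightarrow> bool"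
  where
  "rel_holds lt Equal r s \<longleftrightarrow> r = s"
| "rel_holds lt (Comparison c) r s \<longleftrightarrow> comparison_holds lt c r s"


subsection \<open>Variables and instances\<close>

primrec vars_term :: "'c mg_term \<Rightarrow> nat set" where
  "vars_term (Pre r) = {}"
| "vars_term (MVar v) = {v}"
| "vars_term (Abs t) = vars_term t"
| "vars_term (Bin b t u) = vars_term t \<union> vars_term u"

primrec vars_atom :: "'c mg_atom \<Rightarrow> nat set" where
  "vars_atom (Atom p ts) = (\<Union>t\<in>set ts. vars_term t)"

primrec vars_literal :: "'c literal \<Rightarrow> nat set" where
  "vars_literal (Pos A) = vars_atom A"
| "vars_literal (Neg A) = vars_atom A"
| "vars_literal (NegNeg A) = vars_atom A"

primrec vars_conjunct :: "'c conjunct \<Rightarrow> nat set" where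
  "vars_conjunct (Lit L) = vars_literal L"
| "vars_conjunct (Comp r t u) = vars_term t \<union> vars_term u"

primrec vars_head :: "'c head \<Rightarrow> nat set" where
  "vars_head (Basic A) = vars_atom A"
| "vars_head (Choice A) = vars_atom A"
| "vars_head Constraint = {}"

primrec vars_rule :: "'c mg_rule \<Rightarrow> nat set" where
  "vars_rule (Rule h b) = vars_head h \<union> (\<Union>c\<in>set b. vars_conjunct c)"

definition vars_program :: "'c program \<Rightarrow> nat set" where
  "vars_program \<Pi> = (\<Union>R\<in>\<Pi>. vars_rule R)"

primrec inst_term :: "(nat \<Rightarrow> 'c precomputed) \<Rightarrow> 'c mg_term \<Rightarrow> 'c mg_term" where
  "inst_term \<theta> (Pre r) = Pre r"
| "inst_term \<theta> (MVar v) = Pre (\<theta> v)"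
| "inst_term \<theta> (Abs t) = Abs (inst_term \<theta> t)"
| "inst_term \<theta> (Bin b t u) = Bin b (inst_term \<theta> t) (inst_term \<theta> u)"

primrec inst_atom :: "(nat \<Rightarrow> 'c precomputed) \<Rightarrow> 'c mg_atom \<Rightarrow> 'c mg_atom" where
  "inst_atom \<theta> (Atom p ts) = Atom p (map (inst_term \<theta>) ts)"

primrec inst_literal :: "(nat \<Rightarrow> 'c precomputed) \<Rightarrow> 'c literal \<Rightarrow> 'c literal" where
  "inst_literal \<theta> (Pos A) = Pos (inst_atom \<theta> A)"
| "inst_literal \<theta> (Neg A) = Neg (inst_atom \<theta> A)"
| "inst_literal \<theta> (NegNeg A) = NegNeg (inst_atom \<theta> A)"

primrec inst_conjunct :: "(nat \<Rightarrow> 'c precomputed) \<Rightarrow> 'c conjunct \<Rightarrow> 'c conjunct" where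
  "inst_conjunct \<theta> (Lit L) = Lit (inst_literal \<theta> L)"
| "inst_conjunct \<theta> (Comp r t u) = Comp r (inst_term \<theta> t) (inst_term \<theta> u)"

primrec inst_head :: "(nat \<Rightarrow> 'c precomputed) \<Rightarrow> 'c head \<Rightarrow> 'c head" where
  "inst_head \<theta> (Basic A) = Basic (inst_atom \<theta> A)"
| "inst_head \<theta> (Choice A) = Choice (inst_atom \<theta> A)"
| "inst_head \<theta> Constraint = Constraint"

primrec inst_rule :: "(nat \<Rightarrow> 'c precomputed) \<Rightarrow> 'c mg_rule \<Rightarrow> 'c mg_rule" where
  "inst_rule \<theta> (Rule h b) = Rule (inst_head \<theta> h) (map (inst_conjunct \<theta>) b)"


subsection \<open>Values of ground terms\<close>

definition round_to_zero :: "real \<Rightarrow> int" where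
  "round_to_zero x = (if x \<ge> 0 then \<lfloor>x\<rfloor> else \<lceil>x\<rceil>)"

definition int_quotient :: "int \<Rightarrow> int \<Rightarrow> int" where
  "int_quotient m n = round_to_zero (real_of_int m / real_of_int n)"

text \<open>The values of the operations on a pair of integers; there are none for division by zero.\<close>

fun op_values :: "mg_op \<Rightarrow> int \<Rightarrow> int \<Rightarrow> int set" where
  "op_values Add m n = {m + n}"
| "op_values Sub m n = {m - n}"
| "op_values Mul m n = {m * n}"
| "op_values Div m n = (if n \<noteq> 0 then {int_quotient m n} else {})"
| "op_values Mod m n = (if n \<noteq> 0 then {m - n * int_quotient m n} else {})"
| "op_values Interval m n = {m..n}"

text \<open>Only ground terms are of interest; the value for a variable is a dummy.\<close>

fun vals :: "'c mg_term \<Rightarrow> 'c precomputed set" where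
  "vals (Pre r) = {r}"
| "vals (MVar v) = {}"
| "vals (Abs t) = {Numeral \<bar>n\<bar> | n. Numeral n \<in> vals t}"
| "vals (Bin b t u) =
     {Numeral k | k m n. Numeral m \<in> vals t \<and> Numeral n \<in> vals u \<and> k \<in> op_values b m n}"

definition vals_tuple :: "'c mg_term list \<Rightarrow> 'c precomputed list set" where
  "vals_tuple ts = listset (map vals ts)"

lemma finite_vals: "finite (vals t)"
proof (induction t)
  case (Abs t)
  have "vals (Abs t) \<subseteq> (\<lambda>r. case r of Numeral n \<Rightarrow> Numeral \<bar>n\<bar> | Symbol c \<Rightarrow> Symbol c) ` vals t"
    by force
  then show ?case using Abs finite_surj by blast
next
  case (Bin b t u)
  have fin: "finite (op_values b m n)" for m n by (cases b) auto
  let ?int = "\<lambda>r :: 'a precomputed. case r of Numeral n \<Rightarrow> n | Symbol c \<Rightarrow> 0"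
  have "vals (Bin b t u) \<subseteq>
      (\<Union>r\<in>vals t. \<Union>s\<in>vals u. Numeral ` op_values b (?int r) (?int s))"
    by force
  moreover have "finite \<dots>" using Bin fin by blast
  ultimately show ?case using finite_subset by blast
qed auto

lemma finite_vals_tuple: "finite (vals_tuple ts)"
  by (induction ts) (auto simp: vals_tuple_def set_Cons_def finite_vals
      intro!: finite_image_set2)


section \<open>Propositional theories and their stable models\<close>

datatype 'a pform =
    PAtom 'a
  | PBot
  | PAnd "'a pform" "'a pform"
  | POr "'a pform" "'a pform"
  | PImp "'a pform" "'a pform"

abbreviation PNot :: "'a pform \<Rightarrow> 'a pform" where
  "PNot F \<equiv> PImp F PBot"

abbreviation PTop :: "'a pform" where
  "PTop \<equiv> PNot PBot"

definition PConj :: "'a pform list \<Rightarrow> 'a pform" where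
  "PConj Fs = foldr PAnd Fs PTop"

definition PDisj :: "'a pform list \<Rightarrow> 'a pform" where
  "PDisj Fs = foldr POr Fs PBot"

primrec psat :: "'a set \<Rightarrow> 'a pform \<Rightarrow> bool" where
  "psat X (PAtom a) \<longleftrightarrow> a \<in> X"
| "psat X PBot \<longleftrightarrow> False"
| "psat X (PAnd F G) \<longleftrightarrow> psat X F \<and> psat X G"
| "psat X (POr F G) \<longleftrightarrow> psat X F \<or> psat X G"
| "psat X (PImp F G) \<longleftrightarrow> (psat X F \<longrightarrow> psat X G)"

text \<open>The reduct replaces every maximal subformula that is not satisfied by \<open>X\<close> with falsity.\<close>

primrec reduct :: "'a set \<Rightarrow> 'a pform \<Rightarrow> 'a pform" where
  "reduct X (PAtom a) = (if psat X (PAtom a) then PAtom a else PBot)"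
| "reduct X PBot = PBot"
| "reduct X (PAnd F G) = (if psat X (PAnd F G) then PAnd (reduct X F) (reduct X G) else PBot)"
| "reduct X (POr F G) = (if psat X (POr F G) then POr (reduct X F) (reduct X G) else PBot)"
| "reduct X (PImp F G) = (if psat X (PImp F G) then PImp (reduct X F) (reduct X G) else PBot)"

definition answer_set :: "'a pform set \<Rightarrow> 'a set \<Rightarrow> bool" where
  "answer_set \<Gamma> X \<longleftrightarrow>
     (\<forall>F\<in>\<Gamma>. psat X (reduct X F)) \<and> \<not> (\<exists>Y. Y \<subset> X \<and> (\<forall>F\<in>\<Gamma>. psat Y (reduct X F)))"


section \<open>Stable models of mini-gringo programs\<close>

definition PConj_on :: "'b set \<Rightarrow> ('b \<Rightarrow> 'a pform) \<Rightarrow> 'a pform" where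
  "PConj_on A F = PConj (map F (list_of A))"

definition PDisj_on :: "'b set \<Rightarrow> ('b \<Rightarrow> 'a pform) \<Rightarrow> 'a pform" where
  "PDisj_on A F = PDisj (map F (list_of A))"

fun tau_literal :: "'c literal \<Rightarrow> 'c patom pform" where
  "tau_literal (Pos (Atom p ts)) = PDisj_on (vals_tuple ts) (\<lambda>rs. PAtom (p, rs))"
| "tau_literal (Neg (Atom p ts)) = PDisj_on (vals_tuple ts) (\<lambda>rs. PNot (PAtom (p, rs)))"
| "tau_literal (NegNeg (Atom p ts)) = PDisj_on (vals_tuple ts) (\<lambda>rs. PNot (PNot (PAtom (p, rs))))"

fun tau_conjunct ::
    "('c precomputed \<Rightarrow> 'c precomputed \<Rightarrow> bool) \<Rightarrow> 'c conjunct \<Rightarrow> 'c patom pform" where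
  "tau_conjunct lt (Lit L) = tau_literal L"
| "tau_conjunct lt (Comp rel t u) =
     (if \<exists>r\<in>vals t. \<exists>s\<in>vals u. rel_holds lt rel r s then PTop else PBot)"

definition tau_body ::
    "('c precomputed \<Rightarrow> 'c precomputed \<Rightarrow> bool) \<Rightarrow> 'c conjunct list \<Rightarrow> 'c patom pform" where
  "tau_body lt b = PConj (map (tau_conjunct lt) b)"

fun tau_rule :: "('c precomputed \<Rightarrow> 'c precomputed \<Rightarrow> bool) \<Rightarrow> 'c mg_rule \<Rightarrow> 'c patom pform" where
  "tau_rule lt (Rule (Basic (Atom p ts)) b) =
     PImp (tau_body lt b) (PConj_on (vals_tuple ts) (\<lambda>rs. PAtom (p, rs)))"
| "tau_rule lt (Rule (Choice (Atom p ts)) b) =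
     PImp (tau_body lt b)
       (PConj_on (vals_tuple ts) (\<lambda>rs. POr (PAtom (p, rs)) (PNot (PAtom (p, rs)))))"
| "tau_rule lt (Rule Constraint b) = PNot (tau_body lt b)"

definition tau :: "('c precomputed \<Rightarrow> 'c precomputed \<Rightarrow> bool) \<Rightarrow> 'c program \<Rightarrow> 'c patom pform set"
  where "tau lt \<Pi> = {tau_rule lt (inst_rule \<theta> R) | \<theta> R. R \<in> \<Pi>}"

definition mg_stable_model ::
    "('c precomputed \<Rightarrow> 'c precomputed \<Rightarrow> bool) \<Rightarrow> 'c program \<Rightarrow> 'c patom set \<Rightarrow> bool" where
  "mg_stable_model lt \<Pi> J \<longleftrightarrow> answer_set (tau lt \<Pi>) J"


section \<open>Many-sorted theories and their stable models\<close>

text \<open>Sorts, function constants, predicate constants and domain elements are drawn from the types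
  \<open>'so\<close>, \<open>'f\<close>, \<open>'p\<close> and \<open>'d\<close>. Object constants are function constants without arguments.
  A variable consists of its sort and an index.\<close>

record ('so, 'f, 'p) signature =
  subsort :: "'so \<Rightarrow> 'so \<Rightarrow> bool"
  fun_args :: "'f \<Rightarrow> 'so list"
  fun_sort :: "'f \<Rightarrow> 'so"
  pred_args :: "'p \<Rightarrow> 'so list"

type_synonym 'so var = "'so \<times> nat"

text \<open>\<open>Name d\<close> is the name of the domain element \<open>d\<close> in the signature extended by names.\<close>

datatype ('so, 'f, 'd) fo_term =
    Var "'so var"
  | Name 'd
  | Fun 'f "('so, 'f, 'd) fo_term list"

datatype ('so, 'f, 'p, 'd) form =
    Pred 'p "('so, 'f, 'd) fo_term list"
  | Eq "('so, 'f, 'd) fo_term" "('so, 'f, 'd) fo_term"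
  | Bot
  | And "('so, 'f, 'p, 'd) form" "('so, 'f, 'p, 'd) form"
  | Or "('so, 'f, 'p, 'd) form" "('so, 'f, 'p, 'd) form"
  | Imp "('so, 'f, 'p, 'd) form" "('so, 'f, 'p, 'd) form"
  | Forall "'so var" "('so, 'f, 'p, 'd) form"
  | Exists "'so var" "('so, 'f, 'p, 'd) form"

abbreviation FNot :: "('so, 'f, 'p, 'd) form \<Rightarrow> ('so, 'f, 'p, 'd) form" where
  "FNot F \<equiv> Imp F Bot"

definition Conj :: "('so, 'f, 'p, 'd) form list \<Rightarrow> ('so, 'f, 'p, 'd) form" where
  "Conj Fs = foldr And Fs (FNot Bot)"

primrec fv_term :: "('so, 'f, 'd) fo_term \<Rightarrow> 'so var set" where
  "fv_term (Var x) = {x}"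
| "fv_term (Name d) = {}"
| "fv_term (Fun f ts) = \<Union> (set (map fv_term ts))"

primrec fv :: "('so, 'f, 'p, 'd) form \<Rightarrow> 'so var set" where
  "fv (Pred p ts) = (\<Union>t\<in>set ts. fv_term t)"
| "fv (Eq t u) = fv_term t \<union> fv_term u"
| "fv Bot = {}"
| "fv (And F G) = fv F \<union> fv G"
| "fv (Or F G) = fv F \<union> fv G"
| "fv (Imp F G) = fv F \<union> fv G"
| "fv (Forall x F) = fv F - {x}"
| "fv (Exists x F) = fv F - {x}"

definition universal_closure :: "('so, 'f, 'p, 'd) form \<Rightarrow> ('so, 'f, 'p, 'd) form" where
  "universal_closure F = foldr Forall (list_of (fv F)) F"

fun has_sort :: "('so, 'f, 'p) signature \<Rightarrow> ('so, 'f, 'd) fo_term \<Rightarrow> 'so \<Rightarrow> bool" where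
  "has_sort \<Sigma> (Var x) s \<longleftrightarrow> subsort \<Sigma> (fst x) s"
| "has_sort \<Sigma> (Name d) s \<longleftrightarrow> False"
| "has_sort \<Sigma> (Fun f ts) s \<longleftrightarrow>
     subsort \<Sigma> (fun_sort \<Sigma> f) s \<and> list_all2 (has_sort \<Sigma>) ts (fun_args \<Sigma> f)"

primrec well_sorted :: "('so, 'f, 'p) signature \<Rightarrow> ('so, 'f, 'p, 'd) form \<Rightarrow> bool" where
  "well_sorted \<Sigma> (Pred p ts) \<longleftrightarrow> list_all2 (has_sort \<Sigma>) ts (pred_args \<Sigma> p)"
| "well_sorted \<Sigma> (Eq t u) \<longleftrightarrow> (\<exists>s. has_sort \<Sigma> t s) \<and> (\<exists>s. has_sort \<Sigma> u s)"
| "well_sorted \<Sigma> Bot \<longleftrightarrow> True"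
| "well_sorted \<Sigma> (And F G) \<longleftrightarrow> well_sorted \<Sigma> F \<and> well_sorted \<Sigma> G"
| "well_sorted \<Sigma> (Or F G) \<longleftrightarrow> well_sorted \<Sigma> F \<and> well_sorted \<Sigma> G"
| "well_sorted \<Sigma> (Imp F G) \<longleftrightarrow> well_sorted \<Sigma> F \<and> well_sorted \<Sigma> G"
| "well_sorted \<Sigma> (Forall x F) \<longleftrightarrow> well_sorted \<Sigma> F"
| "well_sorted \<Sigma> (Exists x F) \<longleftrightarrow> well_sorted \<Sigma> F"

text \<open>Sentences over the signature itself, without names of domain elements.\<close>

definition sentence :: "('so, 'f, 'p) signature \<Rightarrow> ('so, 'f, 'p, 'd) form \<Rightarrow> bool" where
  "sentence \<Sigma> F \<longleftrightarrow> well_sorted \<Sigma> F \<and> fv F = {}"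


subsection \<open>Interpretations and satisfaction\<close>

record ('so, 'f, 'p, 'd) interp =
  dom :: "'so \<Rightarrow> 'd set"
  fun_int :: "'f \<Rightarrow> 'd list \<Rightarrow> 'd"
  pred_int :: "'p \<Rightarrow> 'd list \<Rightarrow> bool"

definition args_in :: "('so, 'f, 'p, 'd) interp \<Rightarrow> 'd list \<Rightarrow> 'so list \<Rightarrow> bool" where
  "args_in I ds ss \<longleftrightarrow> list_all2 (\<lambda>d s. d \<in> dom I s) ds ss"

definition is_interp :: "('so, 'f, 'p) signature \<Rightarrow> ('so, 'f, 'p, 'd) interp \<Rightarrow> bool" where
  "is_interp \<Sigma> I \<longleftrightarrow>
     (\<forall>s. dom I s \<noteq> {}) \<and>
     (\<forall>s s'. subsort \<Sigma> s s' \<longrightarrow> dom I s \<subseteq> dom I s') \<and>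
     (\<forall>f ds. args_in I ds (fun_args \<Sigma> f) \<longrightarrow> fun_int I f ds \<in> dom I (fun_sort \<Sigma> f))"

text \<open>\<open>subst x d F\<close> replaces the free occurrences of \<open>x\<close> in \<open>F\<close> with the name of \<open>d\<close>.\<close>

primrec subst_term :: "'so var \<Rightarrow> 'd \<Rightarrow> ('so, 'f, 'd) fo_term \<Rightarrow> ('so, 'f, 'd) fo_term" where
  "subst_term x d (Var y) = (if y = x then Name d else Var y)"
| "subst_term x d (Name e) = Name e"
| "subst_term x d (Fun f ts) = Fun f (map (subst_term x d) ts)"

primrec subst :: "'so var \<Rightarrow> 'd \<Rightarrow> ('so, 'f, 'p, 'd) form \<Rightarrow> ('so, 'f, 'p, 'd) form" where
  "subst x d (Pred p ts) = Pred p (map (subst_term x d) ts)"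
| "subst x d (Eq t u) = Eq (subst_term x d t) (subst_term x d u)"
| "subst x d Bot = Bot"
| "subst x d (And F G) = And (subst x d F) (subst x d G)"
| "subst x d (Or F G) = Or (subst x d F) (subst x d G)"
| "subst x d (Imp F G) = Imp (subst x d F) (subst x d G)"
| "subst x d (Forall y F) = (if y = x then Forall y F else Forall y (subst x d F))"
| "subst x d (Exists y F) = (if y = x then Exists y F else Exists y (subst x d F))"

primrec depth :: "('so, 'f, 'p, 'd) form \<Rightarrow> nat" where
  "depth (Pred p ts) = 0"
| "depth (Eq t u) = 0"
| "depth Bot = 0"
| "depth (And F G) = Suc (max (depth F) (depth G))"
| "depth (Or F G) = Suc (max (depth F) (depth G))"
| "depth (Imp F G) = Suc (max (depth F) (depth G))"
| "depth (Forall x F) = Suc (depth F)"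
| "depth (Exists x F) = Suc (depth F)"

lemma depth_subst [simp]: "depth (subst x d F) = depth F"
  by (induction F) auto

text \<open>Terms are evaluated only when they are closed; the value of a variable is a dummy.\<close>

primrec eval :: "('so, 'f, 'p, 'd) interp \<Rightarrow> ('so, 'f, 'd) fo_term \<Rightarrow> 'd" where
  "eval I (Var x) = undefined"
| "eval I (Name d) = d"
| "eval I (Fun f ts) = fun_int I f (map (eval I) ts)"

function sat :: "('so, 'f, 'p, 'd) interp \<Rightarrow> ('so, 'f, 'p, 'd) form \<Rightarrow> bool" where
  "sat I (Pred p ts) \<longleftrightarrow> pred_int I p (map (eval I) ts)"
| "sat I (Eq t u) \<longleftrightarrow> eval I t = eval I u"
| "sat I Bot \<longleftrightarrow> False"
| "sat I (And F G) \<longleftrightarrow> sat I F \<and> sat I G"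
| "sat I (Or F G) \<longleftrightarrow> sat I F \<or> sat I G"
| "sat I (Imp F G) \<longleftrightarrow> (sat I F \<longrightarrow> sat I G)"
| "sat I (Forall x F) \<longleftrightarrow> (\<forall>d\<in>dom I (fst x). sat I (subst x d F))"
| "sat I (Exists x F) \<longleftrightarrow> (\<exists>d\<in>dom I (fst x). sat I (subst x d F))"
  by pat_completeness auto
termination by (relation "measure (\<lambda>(I, F). depth F)") auto

text \<open>In what follows \<open>A\<close> is the set of intensional predicate constants; all others are
  extensional. The pair \<open>(p, ds)\<close> is the atom formed by \<open>p\<close> and the names of the members of \<open>ds\<close>.\<close>

definition down ::
    "('so, 'f, 'p) signature \<Rightarrow> 'p set \<Rightarrow> ('so, 'f, 'p, 'd) interp \<Rightarrow> ('p \<times> 'd list) set" where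
  "down \<Sigma> A I = {(p, ds). p \<in> A \<and> args_in I ds (pred_args \<Sigma> p) \<and> sat I (Pred p (map Name ds))}"

function ht_sat ::
    "'p set \<Rightarrow> ('p \<times> 'd list) set \<Rightarrow> ('so, 'f, 'p, 'd) interp \<Rightarrow> ('so, 'f, 'p, 'd) form \<Rightarrow> bool" where
  "ht_sat A H I (Pred p ts) \<longleftrightarrow> (if p \<in> A then (p, map (eval I) ts) \<in> H else sat I (Pred p ts))"
| "ht_sat A H I (Eq t u) \<longleftrightarrow> eval I t = eval I u"
| "ht_sat A H I Bot \<longleftrightarrow> False"
| "ht_sat A H I (And F G) \<longleftrightarrow> ht_sat A H I F \<and> ht_sat A H I G"
| "ht_sat A H I (Or F G) \<longleftrightarrow> ht_sat A H I F \<or> ht_sat A H I G"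
| "ht_sat A H I (Imp F G) \<longleftrightarrow> (\<not> ht_sat A H I F \<or> ht_sat A H I G) \<and> sat I (Imp F G)"
| "ht_sat A H I (Forall x F) \<longleftrightarrow> (\<forall>d\<in>dom I (fst x). ht_sat A H I (subst x d F))"
| "ht_sat A H I (Exists x F) \<longleftrightarrow> (\<exists>d\<in>dom I (fst x). ht_sat A H I (subst x d F))"
  by pat_completeness auto
termination by (relation "measure (\<lambda>(A, H, I, F). depth F)") auto

definition fo_stable_model ::
    "('so, 'f, 'p) signature \<Rightarrow> 'p set \<Rightarrow> ('so, 'f, 'p, 'd) form set \<Rightarrow> ('so, 'f, 'p, 'd) interp \<Rightarrow> bool"
  where
  "fo_stable_model \<Sigma> A \<Gamma> I \<longleftrightarrow>
     is_interp \<Sigma> I \<and> (\<forall>F\<in>\<Gamma>. sat I F) \<and>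
     \<not> (\<exists>H. H \<subset> down \<Sigma> A I \<and> (\<forall>F\<in>\<Gamma>. ht_sat A H I F))"


section \<open>The signature of mini-gringo and its standard interpretations\<close>

datatype sort = General | Integer

datatype 'c fun_sym = Const "'c precomputed" | AbsF | Plus | Minus | Times

text \<open>\<open>PredSym p n\<close> is the predicate symbol \<open>p/n\<close>.\<close>

datatype 'c pred_sym = PredSym 'c nat | CompSym comparison

fun sigma0_fun_args :: "'c fun_sym \<Rightarrow> sort list" where
  "sigma0_fun_args (Const r) = []"
| "sigma0_fun_args AbsF = [Integer]"
| "sigma0_fun_args _ = [Integer, Integer]"

fun sigma0_fun_sort :: "'c fun_sym \<Rightarrow> sort" where
  "sigma0_fun_sort (Const (Symbol c)) = General"
| "sigma0_fun_sort _ = Integer"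

fun sigma0_pred_args :: "'c pred_sym \<Rightarrow> sort list" where
  "sigma0_pred_args (PredSym p n) = replicate n General"
| "sigma0_pred_args (CompSym c) = [General, General]"

definition sigma0 :: "(sort, 'c fun_sym, 'c pred_sym) signature" where
  "sigma0 = \<lparr>
     subsort = (\<lambda>s s'. s = s' \<or> s = Integer \<and> s' = General),
     fun_args = sigma0_fun_args,
     fun_sort = sigma0_fun_sort,
     pred_args = sigma0_pred_args\<rparr>"

definition sigma0_intensional :: "'c pred_sym set" where
  "sigma0_intensional = {PredSym p n | p n. True}"

fun standard_dom :: "sort \<Rightarrow> 'c precomputed set" where
  "standard_dom General = UNIV"
| "standard_dom Integer = range Numeral"

text \<open>The values for arguments of the wrong number or sort are dummies.\<close>

fun standard_fun :: "'c fun_sym \<Rightarrow> 'c precomputed list \<Rightarrow> 'c precomputed" where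
  "standard_fun (Const r) [] = r"
| "standard_fun AbsF [Numeral m] = Numeral \<bar>m\<bar>"
| "standard_fun Plus [Numeral m, Numeral n] = Numeral (m + n)"
| "standard_fun Minus [Numeral m, Numeral n] = Numeral (m - n)"
| "standard_fun Times [Numeral m, Numeral n] = Numeral (m * n)"
| "standard_fun _ _ = undefined"

fun standard_pred ::
    "('c precomputed \<Rightarrow> 'c precomputed \<Rightarrow> bool) \<Rightarrow> 'c patom set \<Rightarrow>
     'c pred_sym \<Rightarrow> 'c precomputed list \<Rightarrow> bool" where
  "standard_pred lt J (PredSym p n) rs \<longleftrightarrow> length rs = n \<and> (p, rs) \<in> J"
| "standard_pred lt J (CompSym c) [r, s] \<longleftrightarrow> comparison_holds lt c r s"
| "standard_pred lt J (CompSym c) _ \<longleftrightarrow> False"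

definition up ::
    "('c precomputed \<Rightarrow> 'c precomputed \<Rightarrow> bool) \<Rightarrow> 'c patom set \<Rightarrow>
     (sort, 'c fun_sym, 'c pred_sym, 'c precomputed) interp" where
  "up lt J = \<lparr>dom = standard_dom, fun_int = standard_fun, pred_int = standard_pred lt J\<rparr>"

lemma is_interp_up: "is_interp sigma0 (up lt J)"
proof -
  have "standard_fun f ds \<in> standard_dom (sigma0_fun_sort f)"
    if "list_all2 (\<lambda>d s. d \<in> standard_dom s) ds (sigma0_fun_args f)"
    for f :: "'a fun_sym" and ds
    using that
    by (cases f; cases "case f of Const r \<Rightarrow> r | _ \<Rightarrow> Numeral 0")
      (auto simp: list_all2_Cons2)
  moreover have "standard_dom s \<noteq> {}" for s by (cases s) auto
  ultimately show ?thesis by (auto simp: is_interp_def args_in_def sigma0_def up_def)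
qed


section \<open>The translation of programs into first-order sentences\<close>

text \<open>Formulas over \<^const>\<open>sigma0\<close>, with names for the elements of a standard domain.\<close>

type_synonym 'c fo_form = "(sort, 'c fun_sym, 'c pred_sym, 'c precomputed) form"
type_synonym 'c fo0_term = "(sort, 'c fun_sym, 'c precomputed) fo_term"

abbreviation numeral_term :: "int \<Rightarrow> 'c fo0_term" where
  "numeral_term n \<equiv> Fun (Const (Numeral n)) []"

abbreviation abs_term :: "'c fo0_term \<Rightarrow> 'c fo0_term" where
  "abs_term t \<equiv> Fun AbsF [t]"

abbreviation plus_term :: "'c fo0_term \<Rightarrow> 'c fo0_term \<Rightarrow> 'c fo0_term" where
  "plus_term t u \<equiv> Fun Plus [t, u]"

abbreviation minus_term :: "'c fo0_term \<Rightarrow> 'c fo0_term \<Rightarrow> 'c fo0_term" where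
  "minus_term t u \<equiv> Fun Minus [t, u]"

abbreviation times_term :: "'c fo0_term \<Rightarrow> 'c fo0_term \<Rightarrow> 'c fo0_term" where
  "times_term t u \<equiv> Fun Times [t, u]"

text \<open>The signature has no unary minus.\<close>

abbreviation uminus_term :: "'c fo0_term \<Rightarrow> 'c fo0_term" where
  "uminus_term t \<equiv> minus_term (numeral_term 0) t"

abbreviation cmp :: "comparison \<Rightarrow> 'c fo0_term \<Rightarrow> 'c fo0_term \<Rightarrow> 'c fo_form" where
  "cmp c t u \<equiv> Pred (CompSym c) [t, u]"

text \<open>The matrix of the formula for division and modulo, with \<open>v\<^sub>1\<close> and \<open>v\<^sub>2\<close> the values of \<open>V\<close>
  in the cases of a nonnegative and of a negative product.\<close>

definition division_form ::
    "sort var \<Rightarrow> sort var \<Rightarrow> sort var \<Rightarrow> sort var \<Rightarrow> 'c fo0_term \<Rightarrow> 'c fo0_term \<Rightarrow> 'c fo_form" where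
  "division_form I J K V v1 v2 =
     And (cmp Leq (times_term (Var K) (abs_term (Var J))) (abs_term (Var I)))
    (And (cmp Less (abs_term (Var I))
            (times_term (plus_term (Var K) (numeral_term 1)) (abs_term (Var J))))
         (Or (And (cmp Geq (times_term (Var I) (Var J)) (numeral_term 0)) (Eq (Var V) v1))
             (And (cmp Less (times_term (Var I) (Var J)) (numeral_term 0)) (Eq (Var V) v2))))"

text \<open>The formula \<open>val\<^sub>t(V)\<close>. All integer variables bound in \<open>val n t V\<close> have an index of at least
  \<open>n\<close>, so that they are fresh if \<open>V\<close> is a general variable or an integer variable with an index
  less than \<open>n\<close>.\<close>

fun val :: "nat \<Rightarrow> 'c mg_term \<Rightarrow> sort var \<Rightarrow> 'c fo_form" where
  "val n (Pre r) V = Eq (Var V) (Fun (Const r) [])"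
| "val n (MVar v) V = Eq (Var V) (Var (General, v))"
| "val n (Abs t) V =
    (let I = (Integer, n)
     in Exists I (And (val (n + 1) t I) (Eq (Var V) (abs_term (Var I)))))"
| "val n (Bin b t u) V =
    (let I = (Integer, n); J = (Integer, n + 1); K = (Integer, n + 2);
         val2 = And (val (n + 3) t I) (val (n + 3) u J)
     in case b of
          Add \<Rightarrow> Exists I (Exists J (And val2 (Eq (Var V) (plus_term (Var I) (Var J)))))
        | Sub \<Rightarrow> Exists I (Exists J (And val2 (Eq (Var V) (minus_term (Var I) (Var J)))))
        | Mul \<Rightarrow> Exists I (Exists J (And val2 (Eq (Var V) (times_term (Var I) (Var J)))))
        | Div \<Rightarrow> Exists I (Exists J (Exists K (And val2
                   (division_form I J K V (Var K) (uminus_term (Var K))))))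
        | Mod \<Rightarrow> Exists I (Exists J (Exists K (And val2
                   (division_form I J K V
                      (minus_term (Var I) (times_term (Var K) (Var J)))
                      (plus_term (Var I) (times_term (Var K) (Var J)))))))
        | Interval \<Rightarrow> Exists I (Exists J (Exists K (And val2
                   (And (cmp Leq (Var I) (Var K))
                   (And (cmp Leq (Var K) (Var J)) (Eq (Var V) (Var K))))))))"

definition val_tuple :: "'c mg_term list \<Rightarrow> sort var list \<Rightarrow> 'c fo_form" where
  "val_tuple ts Vs = Conj (map2 (val 0) ts Vs)"

definition pred_atom :: "'c \<Rightarrow> sort var list \<Rightarrow> 'c fo_form" where
  "pred_atom p Vs = Pred (PredSym p (length Vs)) (map Var Vs)"

text \<open>The first \<open>n\<close> general variables that do not occur in the program.\<close>

definition fresh_vars :: "'c program \<Rightarrow> nat \<Rightarrow> sort var list" where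
  "fresh_vars \<Pi> n = map (\<lambda>i. (General, enumerate (- vars_program \<Pi>) i)) [0..<n]"

definition exists_list :: "'so var list \<Rightarrow> ('so, 'f, 'p, 'd) form \<Rightarrow> ('so, 'f, 'p, 'd) form" where
  "exists_list Vs F = foldr Exists Vs F"

fun tauB_literal :: "'c program \<Rightarrow> 'c literal \<Rightarrow> 'c fo_form" where
  "tauB_literal \<Pi> (Pos (Atom p ts)) =
    (let Vs = fresh_vars \<Pi> (length ts)
     in exists_list Vs (And (val_tuple ts Vs) (pred_atom p Vs)))"
| "tauB_literal \<Pi> (Neg (Atom p ts)) =
    (let Vs = fresh_vars \<Pi> (length ts)
     in exists_list Vs (And (val_tuple ts Vs) (FNot (pred_atom p Vs))))"
| "tauB_literal \<Pi> (NegNeg (Atom p ts)) =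
    (let Vs = fresh_vars \<Pi> (length ts)
     in exists_list Vs (And (val_tuple ts Vs) (FNot (FNot (pred_atom p Vs)))))"

fun rel_form :: "mg_rel \<Rightarrow> 'c fo0_term \<Rightarrow> 'c fo0_term \<Rightarrow> 'c fo_form" where
  "rel_form Equal t u = Eq t u"
| "rel_form (Comparison c) t u = cmp c t u"

fun tauB_conjunct :: "'c program \<Rightarrow> 'c conjunct \<Rightarrow> 'c fo_form" where
  "tauB_conjunct \<Pi> (Lit L) = tauB_literal \<Pi> L"
| "tauB_conjunct \<Pi> (Comp rel t u) =
    (let Vs = fresh_vars \<Pi> 2; V1 = Vs ! 0; V2 = Vs ! 1
     in Exists V1 (Exists V2
          (And (val 0 t V1) (And (val 0 u V2) (rel_form rel (Var V1) (Var V2))))))"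

definition tauB_body :: "'c program \<Rightarrow> 'c conjunct list \<Rightarrow> 'c fo_form" where
  "tauB_body \<Pi> b = Conj (map (tauB_conjunct \<Pi>) b)"

fun tau_star_rule :: "'c program \<Rightarrow> 'c mg_rule \<Rightarrow> 'c fo_form" where
  "tau_star_rule \<Pi> (Rule (Basic (Atom p ts)) b) =
    (let Vs = fresh_vars \<Pi> (length ts)
     in universal_closure
          (Imp (And (val_tuple ts Vs) (tauB_body \<Pi> b)) (pred_atom p Vs)))"
| "tau_star_rule \<Pi> (Rule (Choice (Atom p ts)) b) =
    (let Vs = fresh_vars \<Pi> (length ts)
     in universal_closure
          (Imp (And (val_tuple ts Vs) (And (tauB_body \<Pi> b) (FNot (FNot (pred_atom p Vs)))))
               (pred_atom p Vs)))"
| "tau_star_rule \<Pi> (Rule Constraint b) = universal_closure (Imp (tauB_body \<Pi> b) Bot)"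

definition tau_star :: "'c program \<Rightarrow> 'c fo_form set" where
  "tau_star \<Pi> = tau_star_rule \<Pi> ` \<Pi>"

lemma finite_fv: "finite (fv F)"
proof -
  have "finite (fv_term t)" for t :: "('so, 'f, 'd) fo_term"
    by (induction t) auto
  then show ?thesis by (induction F) auto
qed

lemma sentence_universal_closure:
  assumes "well_sorted \<Sigma> F"
  shows "sentence \<Sigma> (universal_closure F)"
proof -
  have "fv (foldr Forall xs F) = fv F - set xs" for xs by (induction xs) auto
  moreover have "well_sorted \<Sigma> (foldr Forall xs F)" for xs using assms by (induction xs) auto
  ultimately show ?thesis
    by (simp add: sentence_def universal_closure_def list_of[OF finite_fv])
qed

lemma well_sorted_Conj: "well_sorted \<Sigma> (Conj Fs) \<longleftrightarrow> (\<forall>F\<in>set Fs. well_sorted \<Sigma> F)"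
  by (induction Fs) (auto simp: Conj_def)

lemma well_sorted_val: "well_sorted sigma0 (val n t V)"
  by (induction t arbitrary: n V)
    (auto simp: Let_def sigma0_def division_form_def split: mg_op.split)

lemma well_sorted_val_tuple: "well_sorted sigma0 (val_tuple ts Vs)"
  by (auto simp: val_tuple_def well_sorted_Conj well_sorted_val)

lemma well_sorted_pred_atom: "well_sorted sigma0 (pred_atom p (fresh_vars \<Pi> n))"
  by (auto simp: pred_atom_def sigma0_def fresh_vars_def list_all2_conv_all_nth)

lemma well_sorted_exists_list: "well_sorted \<Sigma> (exists_list Vs F) \<longleftrightarrow> well_sorted \<Sigma> F"
  by (induction Vs) (auto simp: exists_list_def)

lemma well_sorted_tauB_literal: "well_sorted sigma0 (tauB_literal \<Pi> L)"
  by (induction \<Pi> L rule: tauB_literal.induct)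
    (auto simp: Let_def well_sorted_exists_list well_sorted_val_tuple well_sorted_pred_atom)

lemma well_sorted_rel_form: "well_sorted sigma0 (rel_form rel (Var V) (Var W))"
  if "fst V = General" "fst W = General"
  using that by (cases rel) (auto simp: sigma0_def)

lemma well_sorted_tauB_body: "well_sorted sigma0 (tauB_body \<Pi> b)"
proof -
  have "well_sorted sigma0 (tauB_conjunct \<Pi> c)" for c
    by (cases c)
      (auto simp: Let_def well_sorted_tauB_literal well_sorted_val fresh_vars_def
        intro!: well_sorted_rel_form)
  then show ?thesis by (auto simp: tauB_body_def well_sorted_Conj)
qed

lemma sentence_tau_star: "F \<in> tau_star \<Pi> \<Longrightarrow> sentence sigma0 F"
proof -
  have "sentence sigma0 (tau_star_rule \<Pi> R)" for R
    by (induction \<Pi> R rule: tau_star_rule.induct)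
      (auto simp: Let_def well_sorted_val_tuple well_sorted_pred_atom well_sorted_tauB_body
        intro!: sentence_universal_closure)
  then show "F \<in> tau_star \<Pi> \<Longrightarrow> sentence sigma0 F" by (auto simp: tau_star_def)
qed

end

theory Submission
  imports Defs
begin

text \<open>Both notions of stability are instances of minimality in the logic of here-and-there: a subset
  \<open>Y\<close> of \<open>X\<close> satisfies the reduct of a propositional formula with respect to \<open>X\<close> iff the pair \<open>(Y, X)\<close>
  satisfies the formula. First-order sentences are evaluated relative to assignments of values to
  variables, so that \<open>val\<^sub>t(V)\<close> says that the value of \<open>V\<close> belongs to the set of values of the instance
  of \<open>t\<close> given by the assignment. It follows, rule by rule, that a pair \<open>(Y, J)\<close> satisfies all
  propositional instances of a rule iff it satisfies the first-order translation of the rule.\<close>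

section \<open>Propositional logic of here-and-there\<close>

primrec prop_ht :: "'a set \<Rightarrow> 'a set \<Rightarrow> 'a pform \<Rightarrow> bool" where
  "prop_ht Y X (PAtom a) \<longleftrightarrow> a \<in> Y"
| "prop_ht Y X PBot \<longleftrightarrow> False"
| "prop_ht Y X (PAnd F G) \<longleftrightarrow> prop_ht Y X F \<and> prop_ht Y X G"
| "prop_ht Y X (POr F G) \<longleftrightarrow> prop_ht Y X F \<or> prop_ht Y X G"
| "prop_ht Y X (PImp F G) \<longleftrightarrow>
     (prop_ht Y X F \<longrightarrow> prop_ht Y X G) \<and> (psat X F \<longrightarrow> psat X G)"

text \<open>Allows truth in the world there to be written with \<open>prop_ht\<close> as well, so
  that one lemma about \<open>prop_ht\<close> serves both worlds.\<close>

lemma prop_ht_total: "prop_ht X X F \<longleftrightarrow> psat X F"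
  by (induction F) auto

lemma prop_ht_persistent: "Y \<subseteq> X \<Longrightarrow> prop_ht Y X F \<Longrightarrow> psat X F"
  by (induction F) auto

text \<open>By persistence the pair \<open>(Y, X)\<close> rejects whatever \<open>X\<close> rejects,
  so replacing those subformulas with \<open>PBot\<close> changes nothing. On the remaining ones the
  clauses for \<open>psat\<close> and \<open>prop_ht\<close> agree.\<close>

lemma psat_reduct: "Y \<subseteq> X \<Longrightarrow> psat Y (reduct X F) \<longleftrightarrow> prop_ht Y X F"
  by (induction F) (auto dest: prop_ht_persistent)

lemma answer_set_iff:
  "answer_set \<Gamma> X \<longleftrightarrow>
     (\<forall>F\<in>\<Gamma>. prop_ht X X F) \<and> \<not> (\<exists>Y. Y \<subset> X \<and> (\<forall>F\<in>\<Gamma>. prop_ht Y X F))"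
proof -
  have "(\<forall>F\<in>\<Gamma>. psat Y (reduct X F)) \<longleftrightarrow> (\<forall>F\<in>\<Gamma>. prop_ht Y X F)" if "Y \<subseteq> X" for Y
    using that by (simp add: psat_reduct)
  then show ?thesis unfolding answer_set_def by (metis psubset_imp_subset subset_refl)
qed

lemma prop_ht_PConj: "prop_ht Y X (PConj Fs) \<longleftrightarrow> (\<forall>F\<in>set Fs. prop_ht Y X F)"
  by (induction Fs) (auto simp: PConj_def)

lemma prop_ht_PDisj: "prop_ht Y X (PDisj Fs) \<longleftrightarrow> (\<exists>F\<in>set Fs. prop_ht Y X F)"
  by (induction Fs) (auto simp: PDisj_def)

lemma prop_ht_PConj_on:
  "finite A \<Longrightarrow> prop_ht Y X (PConj_on A F) \<longleftrightarrow> (\<forall>a\<in>A. prop_ht Y X (F a))"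
  using list_of[of A] by (simp add: PConj_on_def prop_ht_PConj)

lemma prop_ht_PDisj_on:
  "finite A \<Longrightarrow> prop_ht Y X (PDisj_on A F) \<longleftrightarrow> (\<exists>a\<in>A. prop_ht Y X (F a))"
  using list_of[of A] by (simp add: PDisj_on_def prop_ht_PDisj)


section \<open>First-order here-and-there satisfaction with assignments\<close>

text \<open>Unlike \<open>eval\<close>, this gives open terms a value, so that formulas can be
  treated by structural induction instead of by substitution of names.\<close>

primrec env_eval ::
    "('so, 'f, 'p, 'd) interp \<Rightarrow> ('so var \<Rightarrow> 'd) \<Rightarrow> ('so, 'f, 'd) fo_term \<Rightarrow> 'd" where
  "env_eval I e (Var x) = e x"
| "env_eval I e (Name d) = d"
| "env_eval I e (Fun f ts) = fun_int I f (map (env_eval I e) ts)"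

text \<open>The predicate \<open>P\<close> interprets the predicate constants in the world \<open>here\<close>; the world \<open>there\<close>
  is \<open>I\<close> itself.\<close>

primrec env_ht ::
    "('so, 'f, 'p, 'd) interp \<Rightarrow> ('p \<Rightarrow> 'd list \<Rightarrow> bool) \<Rightarrow> ('so var \<Rightarrow> 'd) \<Rightarrow>
     ('so, 'f, 'p, 'd) form \<Rightarrow> bool" where
  "env_ht I P e (Pred p ts) \<longleftrightarrow> P p (map (env_eval I e) ts)"
| "env_ht I P e (Eq t u) \<longleftrightarrow> env_eval I e t = env_eval I e u"
| "env_ht I P e Bot \<longleftrightarrow> False"
| "env_ht I P e (And F G) \<longleftrightarrow> env_ht I P e F \<and> env_ht I P e G"
| "env_ht I P e (Or F G) \<longleftrightarrow> env_ht I P e F \<or> env_ht I P e G"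
| "env_ht I P e (Imp F G) \<longleftrightarrow>
     (env_ht I P e F \<longrightarrow> env_ht I P e G) \<and>
     (env_ht I (pred_int I) e F \<longrightarrow> env_ht I (pred_int I) e G)"
| "env_ht I P e (Forall x F) \<longleftrightarrow> (\<forall>d\<in>dom I (fst x). env_ht I P (e(x := d)) F)"
| "env_ht I P e (Exists x F) \<longleftrightarrow> (\<exists>d\<in>dom I (fst x). env_ht I P (e(x := d)) F)"

lemma env_eval_subst: "env_eval I e (subst_term x d t) = env_eval I (e(x := d)) t"
  by (induction t) (auto simp: comp_def cong: map_cong)

lemma env_ht_subst: "env_ht I P e (subst x d F) \<longleftrightarrow> env_ht I P (e(x := d)) F"
  \<comment> \<open>\<open>P\<close> is generalised because the clause for implication switches to
    \<open>pred_int I\<close>, and \<open>e\<close> because quantifiers update it.\<close>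
  by (induction F arbitrary: P e) (auto simp: env_eval_subst comp_def fun_upd_twist)

text \<open>Keeps formulas closed when \<open>sat\<close> and \<open>ht_sat\<close> descend below a
  quantifier.\<close>

lemma fv_subst:
  fixes F :: "('so, 'f, 'p, 'd) form"
  shows "fv (subst x d F) = fv F - {x}"
proof -
  have "fv_term (subst_term x d t) = fv_term t - {x}" for t :: "('so, 'f, 'd) fo_term"
    by (induction t) auto
  then show ?thesis by (induction F) auto
qed

lemma env_eval_closed: "fv_term t = {} \<Longrightarrow> eval I t = env_eval I e t"
  by (induction t) (auto cong: map_cong)

text \<open>The induction follows the recursion of \<open>sat\<close>, since
  \<open>subst x d F\<close> is not a subformula of the quantified formula. In the quantifier cases
  \<open>env_ht_subst\<close> trades the name for an update of \<open>e\<close>.\<close>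

lemma sat_iff_env_ht: "fv F = {} \<Longrightarrow> sat I F \<longleftrightarrow> env_ht I (pred_int I) e F"
proof (induction I F rule: sat.induct)
  case (1 I p ts)
  then have "map (eval I) ts = map (env_eval I e) ts" by (auto intro: env_eval_closed)
  then show ?case by (simp only: sat.simps env_ht.simps)
qed (auto simp: env_eval_closed[where e = e] fv_subst env_ht_subst)

lemma ht_sat_iff_env_ht:
  "fv F = {} \<Longrightarrow> ht_sat A H I F \<longleftrightarrow>
     env_ht I (\<lambda>p ds. if p \<in> A then (p, ds) \<in> H else pred_int I p ds) e F"
proof (induction A H I F rule: ht_sat.induct)
  case (1 A H I p ts)
  then have "map (eval I) ts = map (env_eval I e) ts" by (auto intro: env_eval_closed)
  then show ?case by (simp only: ht_sat.simps sat.simps env_ht.simps)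
qed (auto simp: env_eval_closed[where e = e] fv_subst env_ht_subst sat_iff_env_ht[where e = e])

lemma env_eval_cong: "(\<And>x. x \<in> fv_term t \<Longrightarrow> e x = e' x) \<Longrightarrow> env_eval I e t = env_eval I e' t"
proof (induction t)
  case (Fun f ts)
  then have "map (env_eval I e) ts = map (env_eval I e') ts" by auto
  then show ?case by (simp only: env_eval.simps)
qed auto

lemma env_ht_cong: "(\<And>x. x \<in> fv F \<Longrightarrow> e x = e' x) \<Longrightarrow> env_ht I P e F \<longleftrightarrow> env_ht I P e' F"
proof (induction F arbitrary: P e e')
  case (Pred p ts)
  then have "map (env_eval I e) ts = map (env_eval I e') ts" by (auto intro!: env_eval_cong)
  then show ?case by (simp only: env_ht.simps)
next
  case (Eq t u)
  then have "env_eval I e t = env_eval I e' t" "env_eval I e u = env_eval I e' u"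
    by (auto intro!: env_eval_cong)
  then show ?case by simp
next
  case (And F G)
  have "env_ht I P e F = env_ht I P e' F" "env_ht I P e G = env_ht I P e' G"
    using And.prems by (auto intro!: And.IH)
  then show ?case by simp
next
  case (Or F G)
  have "env_ht I P e F = env_ht I P e' F" "env_ht I P e G = env_ht I P e' G"
    using Or.prems by (auto intro!: Or.IH)
  then show ?case by simp
next
  case (Imp F G)
  have "env_ht I P e F = env_ht I P e' F" "env_ht I P e G = env_ht I P e' G" for P
    using Imp.prems by (auto intro!: Imp.IH)
  then show ?case by simp
next
  case (Forall x F)
  have "env_ht I P (e(x := d)) F = env_ht I P (e'(x := d)) F" for d
    using Forall.prems by (auto intro!: Forall.IH)
  then show ?case by simp
next
  case (Exists x F)
  have "env_ht I P (e(x := d)) F = env_ht I P (e'(x := d)) F" for d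
    using Exists.prems by (auto intro!: Exists.IH)
  then show ?case by simp
qed simp

section \<open>Blocks of quantifiers as simultaneous choices of values\<close>

lemma env_ht_Forall_list:
  "env_ht I P e (foldr Forall xs F) \<longleftrightarrow>
     (\<forall>e'. (\<forall>x\<in>set xs. e' x \<in> dom I (fst x)) \<and> (\<forall>x. x \<notin> set xs \<longrightarrow> e' x = e x) \<longrightarrow>
        env_ht I P e' F)"
proof (induction xs arbitrary: e)
  case Nil
  have "e' = e" if "\<forall>x. e' x = e x" for e' using that by auto
  then show ?case by auto
next
  case (Cons y ys)
  show ?case (is "?L \<longleftrightarrow> ?R")
  proof
    assume L: ?L
    show ?R
    proof (intro allI impI, elim conjE)
      fix e'
      assume e': "\<forall>x\<in>set (y # ys). e' x \<in> dom I (fst x)" "\<forall>x. x \<notin> set (y # ys) \<longrightarrow> e' x = e x"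
      then have "env_ht I P (e(y := e' y)) (foldr Forall ys F)" using L by simp
      then show "env_ht I P e' F" using e' unfolding Cons.IH by auto
    qed
  next
    assume R: ?R
    have "env_ht I P (e(y := d)) (foldr Forall ys F)" if "d \<in> dom I (fst y)" for d
      unfolding Cons.IH
    proof (intro allI impI, elim conjE)
      fix e'
      assume e': "\<forall>x\<in>set ys. e' x \<in> dom I (fst x)"
        "\<forall>x. x \<notin> set ys \<longrightarrow> e' x = (e(y := d)) x"
      \<comment> \<open>If \<open>y\<close> is bound again in \<open>ys\<close>, the inner
        quantifier determines \<open>e' y\<close>; otherwise \<open>e' y\<close> is
        \<open>d\<close>.\<close>
      have "e' y \<in> dom I (fst y)" using e' that by (cases "y \<in> set ys") (metis, metis fun_upd_same)
      then show "env_ht I P e' F" using R e' by auto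
    qed
    then show ?L by simp
  qed
qed

lemma env_ht_universal_closure:
  assumes "\<And>s. dom I s \<noteq> {}"
  shows "env_ht I P e (universal_closure F) \<longleftrightarrow>
    (\<forall>e :: _ var \<Rightarrow> _. (\<forall>x. e x \<in> dom I (fst x)) \<longrightarrow> env_ht I P e F)" (is "?L \<longleftrightarrow> ?R")
proof -
  have set: "set (list_of (fv F)) = fv F" by (simp add: list_of finite_fv)
  show ?thesis
    unfolding universal_closure_def env_ht_Forall_list set
  proof (intro iffI allI impI; (elim conjE)?)
    fix e1 :: "_ var \<Rightarrow> _"
    assume *: "\<forall>e' :: _ var \<Rightarrow> _. (\<forall>x\<in>fv F. e' x \<in> dom I (fst x)) \<and> (\<forall>x. x \<notin> fv F \<longrightarrow> e' x = e x) \<longrightarrow>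
        env_ht I P e' F" and e1: "\<forall>x. e1 x \<in> dom I (fst x)"
    \<comment> \<open>The quantifier block leaves \<open>e\<close> untouched outside the free
      variables, where \<open>F\<close> does not look.\<close>
    have "env_ht I P (\<lambda>x. if x \<in> fv F then e1 x else e x) F"
      by (rule *[rule_format]) (use e1 in auto)
    then show "env_ht I P e1 F" by (rule env_ht_cong[THEN iffD1, rotated]) auto
  next
    fix e1 :: "_ var \<Rightarrow> _"
    assume *: "\<forall>e :: _ var \<Rightarrow> _. (\<forall>x. e x \<in> dom I (fst x)) \<longrightarrow> env_ht I P e F"
      and e1: "\<forall>x\<in>fv F. e1 x \<in> dom I (fst x)"
    \<comment> \<open>Outside the free variables \<open>e1\<close> may violate the sorts; nonempty
      domains supply admissible values there.\<close>
    have "env_ht I P (\<lambda>x. if x \<in> fv F then e1 x else (SOME d. d \<in> dom I (fst x))) F"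
      by (rule *[rule_format]) (use e1 assms in \<open>auto simp: some_in_eq\<close>)
    then show "env_ht I P e1 F" by (rule env_ht_cong[THEN iffD1, rotated]) auto
  qed
qed

lemma env_ht_exists_list:
  "env_ht I P e (exists_list xs F) \<longleftrightarrow>
     (\<exists>e'. (\<forall>x\<in>set xs. e' x \<in> dom I (fst x)) \<and> (\<forall>x. x \<notin> set xs \<longrightarrow> e' x = e x) \<and>
        env_ht I P e' F)"
  unfolding exists_list_def
proof (induction xs arbitrary: e)
  case Nil
  have "e' = e" if "\<forall>x. e' x = e x" for e' using that by auto
  then show ?case by auto
next
  case (Cons y ys)
  show ?case (is "?L \<longleftrightarrow> ?R")
  proof
    assume ?L
    then obtain d e' where d: "d \<in> dom I (fst y)" and e': "\<forall>x\<in>set ys. e' x \<in> dom I (fst x)"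
      "\<forall>x. x \<notin> set ys \<longrightarrow> e' x = (e(y := d)) x" "env_ht I P e' F"
      by (auto simp: Cons.IH)
    have "e' y \<in> dom I (fst y)" using e' d by (cases "y \<in> set ys") (metis, metis fun_upd_same)
    then show ?R using e' by auto
  next
    assume ?R
    then obtain e' where e': "\<forall>x\<in>set (y # ys). e' x \<in> dom I (fst x)"
      "\<forall>x. x \<notin> set (y # ys) \<longrightarrow> e' x = e x" "env_ht I P e' F" by blast
    then have "env_ht I P (e(y := e' y)) (foldr Exists ys F)" unfolding Cons.IH by auto
    then show ?L using e' by auto
  qed
qed

lemma env_ht_Conj: "env_ht I P e (Conj Fs) \<longleftrightarrow> (\<forall>F\<in>set Fs. env_ht I P e F)"
  by (induction Fs) (auto simp: Conj_def)


section \<open>The formula \<open>val\<^sub>t(V)\<close>\<close>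

text \<open>Rounding towards zero takes the floor of the absolute value and restores the sign, and
  \<open>m / n\<close> has the sign of \<open>m * n\<close>. This is the case distinction made in
  \<open>division_form\<close>. For \<open>n = 0\<close> both sides are 0.\<close>

lemma int_quotient_eq:
  "int_quotient m n = (if m * n \<ge> 0 then \<bar>m\<bar> div \<bar>n\<bar> else - (\<bar>m\<bar> div \<bar>n\<bar>))"
proof -
  have "\<bar>m\<bar> div \<bar>n\<bar> = \<lfloor>\<bar>real_of_int m / real_of_int n\<bar>\<rfloor>"
    by (simp add: abs_divide flip: of_int_abs floor_divide_of_int_eq)
  moreover have "real_of_int m / real_of_int n \<ge> 0 \<longleftrightarrow> m * n \<ge> 0"
    by (auto simp: zero_le_divide_iff zero_le_mult_iff)
  ultimately show ?thesis
    by (auto simp: int_quotient_def round_to_zero_def ceiling_def simp del: abs_divide)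
qed

text \<open>The bounds in \<open>division_form\<close> determine \<open>K\<close> uniquely as a
  quotient with nonnegative remainder below |n|. They also exclude a zero divisor, for which they
  would give \<open>0 \<le> \<bar>m\<bar> < 0\<close>.\<close>

lemma quotient_abs_iff:
  "k * \<bar>n\<bar> \<le> \<bar>m\<bar> \<and> \<bar>m\<bar> < (k + 1) * \<bar>n\<bar> \<longleftrightarrow> n \<noteq> 0 \<and> k = \<bar>m\<bar> div \<bar>n\<bar>" for k m n :: int
proof
  assume *: "k * \<bar>n\<bar> \<le> \<bar>m\<bar> \<and> \<bar>m\<bar> < (k + 1) * \<bar>n\<bar>"
  then have "n \<noteq> 0" by auto
  moreover have "\<bar>m\<bar> div \<bar>n\<bar> = k"
    using * by (intro int_div_pos_eq[where r = "\<bar>m\<bar> - k * \<bar>n\<bar>"]) (auto simp: algebra_simps)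
  ultimately show "n \<noteq> 0 \<and> k = \<bar>m\<bar> div \<bar>n\<bar>" by simp
next
  assume *: "n \<noteq> 0 \<and> k = \<bar>m\<bar> div \<bar>n\<bar>"
  then have "\<bar>m\<bar> mod \<bar>n\<bar> \<ge> 0" "\<bar>m\<bar> mod \<bar>n\<bar> < \<bar>n\<bar>" by simp_all
  moreover have "\<bar>m\<bar> = k * \<bar>n\<bar> + \<bar>m\<bar> mod \<bar>n\<bar>" using * by simp
  ultimately show "k * \<bar>n\<bar> \<le> \<bar>m\<bar> \<and> \<bar>m\<bar> < (k + 1) * \<bar>n\<bar>"
    unfolding distrib_right by linarith
qed

lemma up_simps [simp]:
  "dom (up lt J) = standard_dom" "fun_int (up lt J) = standard_fun"
  "pred_int (up lt J) = standard_pred lt J"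
  by (simp_all add: up_def)

lemma comparison_holds_Numeral:
  assumes "precomputed_order lt"
  shows "comparison_holds lt Leq (Numeral m) (Numeral n) \<longleftrightarrow> m \<le> n"
    and "comparison_holds lt Geq (Numeral m) (Numeral n) \<longleftrightarrow> m \<ge> n"
    and "comparison_holds lt Less (Numeral m) (Numeral n) \<longleftrightarrow> m < n"
  using assms by (auto simp: precomputed_order_def)

lemma env_ht_division_form:
  assumes "precomputed_order lt" "e I = Numeral m" "e J = Numeral n" "e K = Numeral k"
  shows "env_ht (up lt X) (standard_pred lt Y) e (division_form I J K V v1 v2) \<longleftrightarrow>
    n \<noteq> 0 \<and> k = \<bar>m\<bar> div \<bar>n\<bar> \<and>
    e V = env_eval (up lt X) e (if m * n \<ge> 0 then v1 else v2)"
  using assms(2-) quotient_abs_iff[of k n m]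
  by (auto simp: division_form_def comparison_holds_Numeral[OF assms(1)]
      simp del: comparison_holds.simps)

text \<open>For a negative product the quotient is \<open>- k\<close>, so the remainder
  \<open>m - n * (- k)\<close> is the value of I + K * J.\<close>

lemma env_ht_Div_Mod_form:
  assumes "precomputed_order lt" "e I = Numeral m" "e J = Numeral n" "e K = Numeral k"
  shows env_ht_Div_form: "env_ht (up lt X) (standard_pred lt Y) e
      (division_form I J K V (Var K) (uminus_term (Var K))) \<longleftrightarrow>
    n \<noteq> 0 \<and> k = \<bar>m\<bar> div \<bar>n\<bar> \<and> e V = Numeral (int_quotient m n)"
    and env_ht_Mod_form: "env_ht (up lt X) (standard_pred lt Y) e
      (division_form I J K V (minus_term (Var I) (times_term (Var K) (Var J)))
        (plus_term (Var I) (times_term (Var K) (Var J)))) \<longleftrightarrow>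
    n \<noteq> 0 \<and> k = \<bar>m\<bar> div \<bar>n\<bar> \<and> e V = Numeral (m - n * int_quotient m n)"
  using assms(2-)
  by (auto simp: env_ht_division_form[OF assms] int_quotient_eq mult.commute)

text \<open>The bound variables have sort integer and differ from \<open>V\<close> by the index
  condition. Binding them therefore affects neither \<open>e V\<close> nor the instance of
  \<open>t\<close>, which depends on general variables only. As just equality and comparisons occur,
  the result is the same for all \<open>X\<close> and \<open>Y\<close>.\<close>

lemma env_ht_val:
  assumes lt: "precomputed_order lt"
  shows "fst V = General \<or> snd V < n \<Longrightarrow>
    env_ht (up lt X) (standard_pred lt Y) e (val n t V) \<longleftrightarrow>
      e V \<in> vals (inst_term (\<lambda>v. e (General, v)) t)"
proof (induction t arbitrary: n V e)
  case (Abs t)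
  have "V \<noteq> (Integer, n)" using Abs.prems by auto
  then show ?case by (auto simp: Let_def Abs.IH)
next
  case (Bin b t u)
  have V: "V \<noteq> (Integer, n)" "V \<noteq> (Integer, n + 1)" "V \<noteq> (Integer, Suc n)" "V \<noteq> (Integer, n + 2)"
    "V \<noteq> (Integer, Suc (Suc n))"
    using Bin.prems by auto
  \<comment> \<open>Subterms bind indices from \<open>n + 3\<close> on, so I, J and K meet the index
    condition for them.\<close>
  note IH = Bin.IH(1)[where n = "n + 3"] Bin.IH(2)[where n = "n + 3"]
  show ?case
    using V by (cases b) (auto simp: Let_def IH env_ht_Div_form[OF lt] env_ht_Mod_form[OF lt]
        comparison_holds_Numeral[OF lt] simp del: comparison_holds.simps)
qed auto


section \<open>Translations of program rules\<close>

lemma inst_term_cong: "(\<And>v. v \<in> vars_term t \<Longrightarrow> \<theta> v = \<theta>' v) \<Longrightarrow> inst_term \<theta> t = inst_term \<theta>' t"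
  by (induction t) auto

lemma inst_atom_cong: "(\<And>v. v \<in> vars_atom A \<Longrightarrow> \<theta> v = \<theta>' v) \<Longrightarrow> inst_atom \<theta> A = inst_atom \<theta>' A"
  by (cases A) (auto intro!: inst_term_cong)

lemma inst_conjunct_cong:
  assumes "\<And>v. v \<in> vars_conjunct c \<Longrightarrow> \<theta> v = \<theta>' v"
  shows "inst_conjunct \<theta> c = inst_conjunct \<theta>' c"
proof (cases c)
  case (Lit L)
  then show ?thesis using assms by (cases L) (auto intro!: inst_atom_cong)
next
  case (Comp r t u)
  then show ?thesis using assms by (auto intro!: inst_term_cong)
qed

lemma finite_vars_program: "finite \<Pi> \<Longrightarrow> finite (vars_program \<Pi>)"
proof -
  have t: "finite (vars_term t)" for t :: "'a mg_term" by (induction t) auto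
  have a: "finite (vars_atom A)" for A :: "'a mg_atom" by (cases A) (auto simp: t)
  have l: "finite (vars_literal L)" for L :: "'a literal" by (cases L) (auto simp: a)
  have c: "finite (vars_conjunct c)" for c :: "'a conjunct" by (cases c) (auto simp: t l)
  have h: "finite (vars_head h)" for h :: "'a head" by (cases h) (auto simp: a)
  have "finite (vars_rule R)" for R :: "'a mg_rule" by (cases R) (auto simp: h c)
  then show "finite \<Pi> \<Longrightarrow> finite (vars_program \<Pi>)" by (auto simp: vars_program_def)
qed

lemma length_fresh_vars [simp]: "length (fresh_vars \<Pi> n) = n"
  by (simp add: fresh_vars_def)

lemma fresh_vars_General: "V \<in> set (fresh_vars \<Pi> n) \<Longrightarrow> fst V = General"
  by (auto simp: fresh_vars_def)

lemma
  assumes "finite \<Pi>"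
  shows distinct_fresh_vars: "distinct (fresh_vars \<Pi> n)"
    and fresh_vars_fresh: "v \<in> vars_program \<Pi> \<Longrightarrow> (General, v) \<notin> set (fresh_vars \<Pi> n)"
proof -
  have inf: "infinite (- vars_program \<Pi>)"
    using finite_vars_program[OF assms] by (simp add: Compl_eq_Diff_UNIV)
  show "distinct (fresh_vars \<Pi> n)"
    using inj_enumerate[OF inf] by (auto simp: fresh_vars_def distinct_map inj_on_def)
  show "v \<in> vars_program \<Pi> \<Longrightarrow> (General, v) \<notin> set (fresh_vars \<Pi> n)"
    using enumerate_in_set[OF inf] by (auto simp: fresh_vars_def)
qed

lemma ex_assignment:
  "length xs = length ds \<Longrightarrow> distinct xs \<Longrightarrow>
    \<exists>e'. map e' xs = ds \<and> (\<forall>x. x \<notin> set xs \<longrightarrow> e' x = e x)"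
proof (induction xs ds rule: list_induct2)
  case (Cons x xs d ds)
  then obtain e' where "map e' xs = ds" "\<forall>x. x \<notin> set xs \<longrightarrow> e' x = e x" by auto
  then show ?case using Cons.prems by (intro exI[of _ "e'(x := d)"]) auto
qed auto

section \<open>Tuples of values, literals, comparisons and bodies\<close>

lemma vals_tuple_iff: "rs \<in> vals_tuple ts \<longleftrightarrow> list_all2 (\<lambda>r t. r \<in> vals t) rs ts"
  by (induction ts arbitrary: rs) (auto simp: vals_tuple_def set_Cons_def list_all2_Cons2)

text \<open>Lets a comparison be handled like a literal with two arguments.\<close>

lemma vals_tuple_pair:
  "(\<exists>rs\<in>vals_tuple [t, u]. Q (rs ! 0) (rs ! Suc 0)) \<longleftrightarrow> (\<exists>r\<in>vals t. \<exists>s\<in>vals u. Q r s)"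
  (is "?L \<longleftrightarrow> ?R")
proof
  assume ?L
  then obtain rs where "rs \<in> vals_tuple [t, u]" "Q (rs ! 0) (rs ! Suc 0)" ..
  then show ?R by (auto simp: vals_tuple_iff list_all2_Cons2 intro!: bexI)
next
  assume ?R
  then obtain r s where "r \<in> vals t" "s \<in> vals u" "Q r s" by blast
  then show ?L by (intro bexI[of _ "[r, s]"]) (auto simp: vals_tuple_iff)
qed

lemma env_ht_val_tuple:
  assumes "precomputed_order lt" "length Vs = length ts" "\<And>V. V \<in> set Vs \<Longrightarrow> fst V = General"
  shows "env_ht (up lt X) (standard_pred lt Y) e (val_tuple ts Vs) \<longleftrightarrow>
    map e Vs \<in> vals_tuple (map (inst_term (\<lambda>v. e (General, v))) ts)"
  using assms(2,3)
  by (simp add: val_tuple_def env_ht_Conj all_set_conv_all_nth vals_tuple_iff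
      list_all2_conv_all_nth env_ht_val[OF assms(1)])

lemma env_ht_pred_atom:
  "env_ht (up lt X) (standard_pred lt Y) e (pred_atom p Vs) \<longleftrightarrow> (p, map e Vs) \<in> Y"
  by (simp add: pred_atom_def comp_def)

text \<open>The common core of all body conjuncts. The variables \<open>Vs\<close> do not occur in
  \<open>ts\<close>, so reassigning them leaves the instance of \<open>ts\<close> fixed, and
  choosing their values amounts to choosing a tuple \<open>rs\<close>.\<close>

lemma env_ht_exists_val_tuple:
  fixes \<Pi> :: "'c program"
  assumes "precomputed_order lt" "finite \<Pi>" "(\<Union>t\<in>set ts. vars_term t) \<subseteq> vars_program \<Pi>"
    and Vs: "Vs = fresh_vars \<Pi> (length ts)"
    and Q: "\<And>e. env_ht (up lt X) (standard_pred lt Y) e F \<longleftrightarrow> Q (map e Vs)"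
  shows "env_ht (up lt X) (standard_pred lt Y) e (exists_list Vs (And (val_tuple ts Vs) F)) \<longleftrightarrow>
    (\<exists>rs\<in>vals_tuple (map (inst_term (\<lambda>v. e (General, v))) ts). Q rs)" (is "?L \<longleftrightarrow> ?R")
proof -
  have inst: "map (inst_term (\<lambda>v. e' (General, v))) ts = map (inst_term (\<lambda>v. e (General, v))) ts"
    if "\<forall>x. x \<notin> set Vs \<longrightarrow> e' x = e x" for e'
    using that assms(3) fresh_vars_fresh[OF assms(2)] unfolding Vs
    by (auto intro!: inst_term_cong)
  have vt: "env_ht (up lt X) (standard_pred lt Y) e' (val_tuple ts Vs) \<longleftrightarrow>
    map e' Vs \<in> vals_tuple (map (inst_term (\<lambda>v. e' (General, v))) ts)" for e' :: "sort var \<Rightarrow> _"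
    by (rule env_ht_val_tuple[OF assms(1)]) (auto simp: Vs dest: fresh_vars_General)
  show ?thesis
  proof
    assume ?L
    then obtain e' where e': "\<forall>x. x \<notin> set Vs \<longrightarrow> e' x = e x"
      "env_ht (up lt X) (standard_pred lt Y) e' (And (val_tuple ts Vs) F)"
      by (auto simp only: env_ht_exists_list)
    from e'(2) show ?R unfolding env_ht.simps vt Q inst[OF e'(1)] by blast
  next
    assume ?R
    then obtain rs where rs: "rs \<in> vals_tuple (map (inst_term (\<lambda>v. e (General, v))) ts)" "Q rs" ..
    have len: "length Vs = length rs"
      using rs(1) by (auto simp: vals_tuple_iff Vs dest: list_all2_lengthD)
    have "distinct Vs" by (simp add: Vs distinct_fresh_vars[OF assms(2)])
    then obtain e' where e': "map e' Vs = rs" "\<forall>x. x \<notin> set Vs \<longrightarrow> e' x = e x"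
      using ex_assignment[OF len, of e] by blast
    have "env_ht (up lt X) (standard_pred lt Y) e' (And (val_tuple ts Vs) F)"
      using rs by (simp only: env_ht.simps vt Q inst[OF e'(2)] e'(1) simp_thms)
    \<comment> \<open>Fresh variables are general, and the general domain contains all precomputed
      terms.\<close>
    moreover have "e' x \<in> dom (up lt X) (fst x)" if "x \<in> set Vs" for x
      using that fresh_vars_General[of x \<Pi>] Vs by simp
    ultimately show ?L using e'(2) unfolding env_ht_exists_list by blast
  qed
qed

lemma env_ht_tauB_literal:
  fixes \<Pi> :: "'c program"
  assumes "precomputed_order lt" "finite \<Pi>" "vars_literal L \<subseteq> vars_program \<Pi>"
  shows "env_ht (up lt X) (standard_pred lt Y) e (tauB_literal \<Pi> L) \<longleftrightarrow>
    prop_ht Y X (tau_literal (inst_literal (\<lambda>v. e (General, v)) L))"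
proof -
  let ?V = "\<lambda>ts. fresh_vars \<Pi> (length ts)"
  have ex: "env_ht (up lt X) (standard_pred lt Y) e
      (exists_list (?V ts) (And (val_tuple ts (?V ts)) F)) \<longleftrightarrow>
    (\<exists>rs\<in>vals_tuple (map (inst_term (\<lambda>v. e (General, v))) ts). Q rs)"
    if "(\<Union>t\<in>set ts. vars_term t) \<subseteq> vars_program \<Pi>"
      and "\<And>e. env_ht (up lt X) (standard_pred lt Y) e F \<longleftrightarrow> Q (map e (?V ts))" for ts F Q
    using that by (intro env_ht_exists_val_tuple[OF assms(1,2)] refl)
  show ?thesis
  proof (cases L)
    case (Pos A)
    obtain p ts where A: "A = Atom p ts" by (cases A)
    show ?thesis
      using ex[of ts "pred_atom p (?V ts)" "\<lambda>rs. (p, rs) \<in> Y"] assms(3)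
      by (simp add: Pos A Let_def prop_ht_PDisj_on finite_vals_tuple env_ht_pred_atom)
  next
    case (Neg A)
    obtain p ts where A: "A = Atom p ts" by (cases A)
    show ?thesis
      \<comment> \<open>Negation requires the atom to fail in both worlds.\<close>
      using ex[of ts "FNot (pred_atom p (?V ts))" "\<lambda>rs. (p, rs) \<notin> Y \<and> (p, rs) \<notin> X"] assms(3)
      by (simp add: Neg A Let_def prop_ht_PDisj_on finite_vals_tuple env_ht_pred_atom)
  next
    case (NegNeg A)
    obtain p ts where A: "A = Atom p ts" by (cases A)
    show ?thesis
      \<comment> \<open>The two nested implications written out; the condition amounts to
        \<open>(p, rs) \<in> X\<close>.\<close>
      using ex[of ts "FNot (FNot (pred_atom p (?V ts)))" "\<lambda>rs. \<not> ((p, rs) \<notin> Y \<and> (p, rs) \<notin> X) \<and> (p, rs) \<in> X"] assms(3)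
      by (simp add: NegNeg A Let_def prop_ht_PDisj_on finite_vals_tuple env_ht_pred_atom)
  qed
qed

lemma env_ht_tauB_conjunct:
  fixes \<Pi> :: "'c program"
  assumes "precomputed_order lt" "finite \<Pi>" "vars_conjunct c \<subseteq> vars_program \<Pi>"
  shows "env_ht (up lt X) (standard_pred lt Y) e (tauB_conjunct \<Pi> c) \<longleftrightarrow>
    prop_ht Y X (tau_conjunct lt (inst_conjunct (\<lambda>v. e (General, v)) c))"
proof (cases c)
  case (Lit L)
  then show ?thesis using assms by (simp add: env_ht_tauB_literal)
next
  case (Comp rel t u)
  let ?Vs = "fresh_vars \<Pi> 2"
  obtain V1 V2 where V: "?Vs = [V1, V2]"
    using length_fresh_vars[of \<Pi> 2] by (auto simp: numeral_2_eq_2 length_Suc_conv simp del: length_fresh_vars)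
  have Q: "env_ht (up lt X) (standard_pred lt Y) e (rel_form rel (Var V1) (Var V2)) \<longleftrightarrow>
      rel_holds lt rel (map e ?Vs ! 0) (map e ?Vs ! 1)" for e
    by (cases rel) (auto simp: V)
  \<comment> \<open>Regrouping the conjunction gives the comparison the shape expected by
    \<open>env_ht_exists_val_tuple\<close>.\<close>
  have "env_ht (up lt X) (standard_pred lt Y) e (tauB_conjunct \<Pi> c) \<longleftrightarrow>
      env_ht (up lt X) (standard_pred lt Y) e (exists_list ?Vs
        (And (val_tuple [t, u] ?Vs) (rel_form rel (Var V1) (Var V2))))"
    by (simp add: Comp V exists_list_def val_tuple_def Conj_def conj_ac)
  also have "\<dots> \<longleftrightarrow> (\<exists>rs\<in>vals_tuple (map (inst_term (\<lambda>v. e (General, v))) [t, u]).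
      rel_holds lt rel (rs ! 0) (rs ! 1))"
    using assms(3) by (intro env_ht_exists_val_tuple[OF assms(1,2)] Q) (auto simp: Comp numeral_2_eq_2)
  also have "\<dots> \<longleftrightarrow> prop_ht Y X (tau_conjunct lt (inst_conjunct (\<lambda>v. e (General, v)) c))"
    by (simp add: Comp vals_tuple_pair)
  finally show ?thesis .
qed

lemma env_ht_tauB_body:
  assumes "precomputed_order lt" "finite \<Pi>" "(\<Union>c\<in>set b. vars_conjunct c) \<subseteq> vars_program \<Pi>"
  shows "env_ht (up lt X) (standard_pred lt Y) e (tauB_body \<Pi> b) \<longleftrightarrow>
    prop_ht Y X (tau_body lt (map (inst_conjunct (\<lambda>v. e (General, v))) b))"
proof -
  have "env_ht (up lt X) (standard_pred lt Y) e (tauB_conjunct \<Pi> c) \<longleftrightarrow>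
    prop_ht Y X (tau_conjunct lt (inst_conjunct (\<lambda>v. e (General, v)) c))" if "c \<in> set b" for c
    using assms that by (intro env_ht_tauB_conjunct) auto
  then show ?thesis by (simp add: tauB_body_def tau_body_def env_ht_Conj prop_ht_PConj)
qed

section \<open>Rules: universal closure against all instances\<close>

text \<open>An assignment consists of a substitution for the program variables and an independent
  tuple for the fresh ones. The fresh variables also enter
  \<open>\<lambda>v. e (General, v)\<close>, hence the invariance condition on
  \<open>Q\<close>.\<close>

lemma all_assignments_iff:
  fixes Q :: "(nat \<Rightarrow> 'c precomputed) \<Rightarrow> 'c precomputed list \<Rightarrow> bool"
  assumes "finite \<Pi>"
    and Q: "\<And>\<theta> \<theta>' rs. (\<And>v. v \<in> vars_program \<Pi> \<Longrightarrow> \<theta> v = \<theta>' v) \<Longrightarrow> Q \<theta> rs \<Longrightarrow> Q \<theta>' rs"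
  shows "(\<forall>e. (\<forall>x. e x \<in> standard_dom (fst x)) \<longrightarrow>
      Q (\<lambda>v. e (General, v)) (map e (fresh_vars \<Pi> n))) \<longleftrightarrow>
    (\<forall>\<theta> rs. length rs = n \<longrightarrow> Q \<theta> rs)" (is "?L \<longleftrightarrow> ?R")
proof
  assume L: ?L
  show ?R
  proof (intro allI impI)
    fix \<theta> :: "nat \<Rightarrow> 'c precomputed" and rs :: "'c precomputed list"
    assume "length rs = n"
    then have len: "length (fresh_vars \<Pi> n) = length rs" by simp
    \<comment> \<open>Integer variables receive an arbitrary numeral to respect their sort.\<close>
    obtain e' where e': "map e' (fresh_vars \<Pi> n) = rs"
      "\<forall>x. x \<notin> set (fresh_vars \<Pi> n) \<longrightarrow>
        e' x = (case x of (General, v) \<Rightarrow> \<theta> v | (Integer, v) \<Rightarrow> Numeral 0)"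
      using ex_assignment[OF len distinct_fresh_vars[OF assms(1)],
          of "\<lambda>x. case x of (General, v) \<Rightarrow> \<theta> v | (Integer, v) \<Rightarrow> Numeral 0"] by blast
    have "e' x \<in> standard_dom (fst x)" for x
    proof (cases "fst x")
      case Integer
      then have "x \<notin> set (fresh_vars \<Pi> n)" using fresh_vars_General by fastforce
      then show ?thesis using e'(2) Integer by (cases x) auto
    qed simp
    then have "Q (\<lambda>v. e' (General, v)) rs" using L e'(1) by blast
    \<comment> \<open>The substitution read off from \<open>e'\<close> can differ from
      \<open>\<theta>\<close> at fresh variables only.\<close>
    then show "Q \<theta> rs" by (rule Q[rotated]) (simp add: e'(2) fresh_vars_fresh[OF assms(1)])
  qed
qed simp

text \<open>In each case \<open>?Q\<close> states what the rule demands of a substitution and a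
  tuple of head arguments. The closure quantifies over both at once; on the propositional side the
  substitution yields the instance and the tuple ranges over the conjunction in the head.\<close>

lemma env_ht_tau_star_rule:
  fixes \<Pi> :: "'c program"
  assumes lt: "precomputed_order lt" and fin: "finite \<Pi>" and R: "R \<in> \<Pi>" and "Y \<subseteq> J"
  shows "env_ht (up lt J) (standard_pred lt Y) e (tau_star_rule \<Pi> R) \<longleftrightarrow>
    (\<forall>\<theta>. prop_ht Y J (tau_rule lt (inst_rule \<theta> R)))"
proof -
  obtain h b where hb: "R = Rule h b" by (cases R)
  have vars: "vars_rule R \<subseteq> vars_program \<Pi>" using R by (auto simp: vars_program_def)
  have "standard_dom s \<noteq> {}" for s by (cases s) auto
  then have uc: "env_ht (up lt J) (standard_pred lt Y) e (universal_closure F) \<longleftrightarrow>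
      (\<forall>e. (\<forall>x. e x \<in> standard_dom (fst x)) \<longrightarrow> env_ht (up lt J) (standard_pred lt Y) e F)" for e F
    by (subst env_ht_universal_closure) simp_all
  \<comment> \<open>Both \<open>Y\<close> and \<open>J\<close> are used for \<open>Z\<close>, as an
    implication inspects its antecedent in both worlds.\<close>
  have body: "env_ht (up lt J) (standard_pred lt Z) e (tauB_body \<Pi> b) \<longleftrightarrow>
      prop_ht Z J (tau_body lt (map (inst_conjunct (\<lambda>v. e (General, v))) b))" for Z e
    using vars hb by (intro env_ht_tauB_body lt fin) auto
  have bodyc: "map (inst_conjunct \<theta>) b = map (inst_conjunct \<theta>') b"
    if "\<And>v. v \<in> vars_program \<Pi> \<Longrightarrow> \<theta> v = \<theta>' v" for \<theta> \<theta>' :: "nat \<Rightarrow> 'c precomputed"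
    using that vars hb by (auto intro!: inst_conjunct_cong)
  let ?V = "\<lambda>ts. fresh_vars \<Pi> (length ts)"
  let ?B = "\<lambda>Z \<theta>. prop_ht Z J (tau_body lt (map (inst_conjunct \<theta>) b))"
  have vt: "env_ht (up lt J) (standard_pred lt Z) e (val_tuple ts (fresh_vars \<Pi> (length ts))) \<longleftrightarrow>
      map e (fresh_vars \<Pi> (length ts)) \<in> vals_tuple (map (inst_term (\<lambda>v. e (General, v))) ts)"
    for Z e ts
    by (rule env_ht_val_tuple[OF lt]) (auto dest: fresh_vars_General)
  have tsc: "map (inst_term \<theta>) ts = map (inst_term \<theta>') ts"
    if "\<And>v. v \<in> vars_program \<Pi> \<Longrightarrow> \<theta> v = \<theta>' v" "(\<Union>t\<in>set ts. vars_term t) \<subseteq> vars_program \<Pi>"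
    for ts and \<theta> \<theta>' :: "nat \<Rightarrow> 'c precomputed"
    using that by (auto intro!: inst_term_cong)
  have len: "length rs = length ts" if "rs \<in> vals_tuple (map (inst_term \<theta>) ts)"
    for rs \<theta> and ts :: "'c mg_term list"
    using that by (auto simp: vals_tuple_iff dest: list_all2_lengthD)
  show ?thesis
  proof (cases h)
    case (Basic A)
    obtain p ts where A: "A = Atom p ts" by (cases A)
    have ts: "(\<Union>t\<in>set ts. vars_term t) \<subseteq> vars_program \<Pi>" using vars hb Basic A by auto
    \<comment> \<open>The two conjuncts are the implication here and there.\<close>
    let ?Q = "\<lambda>\<theta> rs. rs \<in> vals_tuple (map (inst_term \<theta>) ts) \<longrightarrow>
        (?B Y \<theta> \<longrightarrow> (p, rs) \<in> Y) \<and> (?B J \<theta> \<longrightarrow> (p, rs) \<in> J)"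
    have step: "(\<forall>rs. length rs = length ts \<longrightarrow> ?Q \<theta> rs) \<longleftrightarrow>
        prop_ht Y J (tau_rule lt (inst_rule \<theta> R))" for \<theta>
      using len[of _ \<theta> ts]
      by (auto simp: hb Basic A prop_ht_PConj_on finite_vals_tuple
          simp flip: prop_ht_total)
    have "env_ht (up lt J) (standard_pred lt Y) e
          (Imp (And (val_tuple ts (?V ts)) (tauB_body \<Pi> b)) (pred_atom p (?V ts))) \<longleftrightarrow>
        ?Q (\<lambda>v. e (General, v)) (map e (?V ts))" for e
      by (simp only: env_ht.simps up_simps vt body env_ht_pred_atom) blast
    then have "env_ht (up lt J) (standard_pred lt Y) e (tau_star_rule \<Pi> R) \<longleftrightarrow>
        (\<forall>e. (\<forall>x. e x \<in> standard_dom (fst x)) \<longrightarrow>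
          ?Q (\<lambda>v. e (General, v)) (map e (?V ts)))"
      by (simp only: hb Basic A tau_star_rule.simps Let_def uc)
    also have "\<dots> \<longleftrightarrow> (\<forall>\<theta> rs. length rs = length ts \<longrightarrow> ?Q \<theta> rs)"
    proof (rule all_assignments_iff[OF fin, where Q = ?Q])
      fix \<theta> \<theta>' :: "nat \<Rightarrow> 'c precomputed" and rs
      assume agree: "\<And>v. v \<in> vars_program \<Pi> \<Longrightarrow> \<theta> v = \<theta>' v" and "?Q \<theta> rs"
      then show "?Q \<theta>' rs" by (simp only: bodyc[OF agree] tsc[OF agree ts])
    qed
    also have "\<dots> \<longleftrightarrow> (\<forall>\<theta>. prop_ht Y J (tau_rule lt (inst_rule \<theta> R)))"
      by (simp only: step)
    finally show ?thesis .
  next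
    case (Choice A)
    obtain p ts where A: "A = Atom p ts" by (cases A)
    have ts: "(\<Union>t\<in>set ts. vars_term t) \<subseteq> vars_program \<Pi>" using vars hb Choice A by auto
    \<comment> \<open>In the world there a choice rule demands nothing. Here, given
      \<open>Y \<subseteq> J\<close>, the head \<open>A \<or> \<not>A\<close> and the extra premise
      \<open>\<not>\<not>A\<close> both come down to this: an atom in \<open>J\<close> must be in
      \<open>Y\<close>.\<close>
    let ?Q = "\<lambda>\<theta> rs. rs \<in> vals_tuple (map (inst_term \<theta>) ts) \<longrightarrow>
        ?B Y \<theta> \<longrightarrow> (p, rs) \<in> J \<longrightarrow> (p, rs) \<in> Y"
    have step: "(\<forall>rs. length rs = length ts \<longrightarrow> ?Q \<theta> rs) \<longleftrightarrow>
        prop_ht Y J (tau_rule lt (inst_rule \<theta> R))" for \<theta>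
      using len[of _ \<theta> ts] \<open>Y \<subseteq> J\<close>
      by (auto simp: hb Choice A prop_ht_PConj_on finite_vals_tuple
          simp flip: prop_ht_total)
    have "env_ht (up lt J) (standard_pred lt Y) e
          (Imp (And (val_tuple ts (?V ts))
                 (And (tauB_body \<Pi> b) (FNot (FNot (pred_atom p (?V ts))))))
            (pred_atom p (?V ts))) \<longleftrightarrow>
        ?Q (\<lambda>v. e (General, v)) (map e (?V ts))" for e
      using \<open>Y \<subseteq> J\<close> by (simp only: env_ht.simps up_simps vt body env_ht_pred_atom) blast
    then have "env_ht (up lt J) (standard_pred lt Y) e (tau_star_rule \<Pi> R) \<longleftrightarrow>
        (\<forall>e. (\<forall>x. e x \<in> standard_dom (fst x)) \<longrightarrow>
          ?Q (\<lambda>v. e (General, v)) (map e (?V ts)))"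
      by (simp only: hb Choice A tau_star_rule.simps Let_def uc)
    also have "\<dots> \<longleftrightarrow> (\<forall>\<theta> rs. length rs = length ts \<longrightarrow> ?Q \<theta> rs)"
    proof (rule all_assignments_iff[OF fin, where Q = ?Q])
      fix \<theta> \<theta>' :: "nat \<Rightarrow> 'c precomputed" and rs
      assume agree: "\<And>v. v \<in> vars_program \<Pi> \<Longrightarrow> \<theta> v = \<theta>' v" and "?Q \<theta> rs"
      then show "?Q \<theta>' rs" by (simp only: bodyc[OF agree] tsc[OF agree ts])
    qed
    also have "\<dots> \<longleftrightarrow> (\<forall>\<theta>. prop_ht Y J (tau_rule lt (inst_rule \<theta> R)))"
      by (simp only: step)
    finally show ?thesis .
  next
    case Constraint
    \<comment> \<open>Without a head there are no arguments, so \<open>rs\<close> is a dummy of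
      length 0.\<close>
    let ?Q = "\<lambda>\<theta> (rs :: 'c precomputed list). \<not> ?B Y \<theta> \<and> \<not> ?B J \<theta>"
    have "env_ht (up lt J) (standard_pred lt Y) e (tau_star_rule \<Pi> R) \<longleftrightarrow>
        (\<forall>e. (\<forall>x. e x \<in> standard_dom (fst x)) \<longrightarrow>
          ?Q (\<lambda>v. e (General, v)) (map e (fresh_vars \<Pi> 0)))"
      unfolding hb Constraint
      by (simp only: tau_star_rule.simps uc env_ht.simps up_simps body) blast
    also have "\<dots> \<longleftrightarrow> (\<forall>\<theta> rs. length rs = 0 \<longrightarrow> ?Q \<theta> rs)"
    proof (rule all_assignments_iff[OF fin, where Q = ?Q])
      fix \<theta> \<theta>' :: "nat \<Rightarrow> 'c precomputed" and rs
      assume agree: "\<And>v. v \<in> vars_program \<Pi> \<Longrightarrow> \<theta> v = \<theta>' v" and "?Q \<theta> rs"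
      then show "?Q \<theta>' rs" by (simp only: bodyc[OF agree] simp_thms)
    qed
    also have "\<dots> \<longleftrightarrow> (\<forall>\<theta>. prop_ht Y J (tau_rule lt (inst_rule \<theta> R)))"
      by (simp add: hb Constraint flip: prop_ht_total)
    finally show ?thesis .
  qed
qed

lemma env_ht_tau_star:
  assumes "precomputed_order lt" "finite \<Pi>" "Y \<subseteq> J"
  shows "(\<forall>F\<in>tau_star \<Pi>. env_ht (up lt J) (standard_pred lt Y) e F) \<longleftrightarrow>
    (\<forall>F\<in>tau lt \<Pi>. prop_ht Y J F)"
  using env_ht_tau_star_rule[OF assms(1,2) _ assms(3), where e = e]
  unfolding tau_star_def tau_def by blast

section \<open>Worlds over the first-order signature and sets of precomputed atoms\<close>

text \<open>First-order predicate symbols carry their arity, while precomputed atoms carry it only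
  as the length of the argument list.\<close>

definition ground_atom :: "'c patom \<Rightarrow> 'c pred_sym \<times> 'c precomputed list" where
  "ground_atom = (\<lambda>(p, rs). (PredSym p (length rs), rs))"

lemma inj_ground_atom: "inj ground_atom"
  by (auto simp: ground_atom_def inj_def)

lemma ground_atom_image_iff:
  "(p, rs) \<in> ground_atom ` Y \<longleftrightarrow> (\<exists>q. p = PredSym q (length rs) \<and> (q, rs) \<in> Y)"
  by (force simp: ground_atom_def image_iff)

lemma down_up: "down sigma0 sigma0_intensional (up lt J) = ground_atom ` J"
proof -
  have "(p, rs) \<in> down sigma0 sigma0_intensional (up lt J) \<longleftrightarrow> (p, rs) \<in> ground_atom ` J" for p rs
    by (cases p) (auto simp: down_def sigma0_intensional_def args_in_def sigma0_def
        ground_atom_image_iff comp_def list_all2_conv_all_nth)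
  then show ?thesis unfolding set_eq_iff split_paired_All by blast
qed

text \<open>Turns the candidates \<open>H\<close> of first-order minimality into the candidates
  \<open>Y\<close> of propositional minimality; injectivity keeps the inclusion strict.\<close>

lemma psubset_image_iff:
  assumes "inj f"
  shows "H \<subset> f ` J \<longleftrightarrow> (\<exists>Y. Y \<subset> J \<and> H = f ` Y)"
proof
  assume H: "H \<subset> f ` J"
  then obtain Y where Y: "Y \<subseteq> J" "H = f ` Y" by (meson psubset_imp_subset subset_imageE)
  then have "Y \<noteq> J" using H by blast
  then show "\<exists>Y. Y \<subset> J \<and> H = f ` Y" using Y by blast
next
  assume "\<exists>Y. Y \<subset> J \<and> H = f ` Y"
  then show "H \<subset> f ` J" using image_strict_mono[OF inj_on_subset[OF assms subset_UNIV]] by blast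
qed

lemma ht_sat_up_iff:
  assumes "F \<in> tau_star \<Pi>"
  shows "ht_sat sigma0_intensional (ground_atom ` Y) (up lt J) F \<longleftrightarrow>
    env_ht (up lt J) (standard_pred lt Y) e F"
proof -
  \<comment> \<open>The extensional symbols are the comparisons, whose meaning is the same for
    \<open>J\<close> and \<open>Y\<close>.\<close>
  have "(\<lambda>p ds. if p \<in> sigma0_intensional then (p, ds) \<in> ground_atom ` Y
      else standard_pred lt J p ds) = standard_pred lt Y"
  proof (intro ext)
    fix p ds
    show "(if p \<in> sigma0_intensional then (p, ds) \<in> ground_atom ` Y
      else standard_pred lt J p ds) = standard_pred lt Y p ds"
    proof (cases p)
      case (PredSym q n)
      then show ?thesis by (auto simp: sigma0_intensional_def ground_atom_image_iff)
    next
      case (CompSym c)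
      have "standard_pred lt J (CompSym c) ds = standard_pred lt Y (CompSym c) ds"
        by (cases "(lt, J, CompSym c :: 'a pred_sym, ds)" rule: standard_pred.cases) auto
      then show ?thesis using CompSym by (auto simp: sigma0_intensional_def)
    qed
  qed
  moreover have "fv F = {}" using sentence_tau_star[OF assms] by (simp add: sentence_def)
  ultimately show ?thesis by (simp only: ht_sat_iff_env_ht[where e = e] up_simps)
qed

theorem theorem1:
  fixes lt :: "'c precomputed \<Rightarrow> 'c precomputed \<Rightarrow> bool"
    and \<Pi> :: "'c program"
    and J :: "'c patom set"
  assumes "countable (UNIV :: 'c set)" and "infinite (UNIV :: 'c set)"
    and "precomputed_order lt"
    and "finite \<Pi>"
  shows "mg_stable_model lt \<Pi> J \<longleftrightarrow>
         fo_stable_model sigma0 sigma0_intensional (tau_star \<Pi>) (up lt J)"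
proof -
  \<comment> \<open>Any assignment will do, as all formulas involved are closed.\<close>
  fix e :: "sort var \<Rightarrow> 'c precomputed"
  have "sat (up lt J) F \<longleftrightarrow> env_ht (up lt J) (standard_pred lt J) e F" if "F \<in> tau_star \<Pi>" for F
    using sentence_tau_star[OF that] by (simp add: sentence_def sat_iff_env_ht[where e = e])
  \<comment> \<open>Being a model is the case of the total pair \<open>(J, J)\<close>.\<close>
  then have sat: "(\<forall>F\<in>tau_star \<Pi>. sat (up lt J) F) \<longleftrightarrow> (\<forall>F\<in>tau lt \<Pi>. prop_ht J J F)"
    using env_ht_tau_star[OF assms(3,4) subset_refl, of J e] by simp
  have ht: "(\<forall>F\<in>tau_star \<Pi>. ht_sat sigma0_intensional (ground_atom ` Y) (up lt J) F) \<longleftrightarrow>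
      (\<forall>F\<in>tau lt \<Pi>. prop_ht Y J F)" if "Y \<subseteq> J" for Y
    using env_ht_tau_star[OF assms(3,4) that, of e] ht_sat_up_iff[of _ \<Pi> Y lt J e] by simp
  have "(\<exists>H. H \<subset> ground_atom ` J \<and>
        (\<forall>F\<in>tau_star \<Pi>. ht_sat sigma0_intensional H (up lt J) F)) \<longleftrightarrow>
      (\<exists>Y. Y \<subset> J \<and> (\<forall>F\<in>tau lt \<Pi>. prop_ht Y J F))"
    unfolding psubset_image_iff[OF inj_ground_atom] using ht by (metis psubset_imp_subset)
  then show ?thesis
    by (simp only: mg_stable_model_def answer_set_iff fo_stable_model_def down_up sat
        is_interp_up simp_thms)
qed

end
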